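(* Let $L>0$ and let $n\ge1$ be an integer. Suppose $a\in L^\infty(0,L)$ satisfies $\lambda_n\prec a$ and there exist points $0=y_0<y_1<\dots<y_{2n+1}<y_{2n+2}=L$ such that $$\max_{0\le i\le 2n+1}\left\{(y_{i+1}-y_i)^2\,\|a\|_{L^\infty(y_i,y_{i+1})}\right\}\le \frac{\pi^2}{4},$$ and, in addition, for at least one index $i\in\{0,\dots,2n+1\}$ the function $a$ is not (a.e.) equal to the constant $\frac{\pi^2}{4(y_{i+1}-y_i)^2}$ on the interval $[y_i,y_{i+1}]$. Then the boundary value problem $$u''(x)+a(x)u(x)=0,\ x\in(0,L),\qquad u'(0)=u'(L)=0$$ has only the trivial solution.
   Context: For $c,d\in L^1(0,L)$ write $c\prec d$ if $c(x)\le d(x)$ for a.e. $x\in[0,L]$ and $c(x)<d(x)$ on a set of positive measure. $\lambda_n=n^2\pi^2/L^2$, also regarded as a constant function. Solutions are real-valued and taken in $H^1(0,L)$ in the weak sense. *)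

theory Defs
  imports "HOL-Analysis.Analysis" "HOL-Probability.Essential_Supremum"
begin

(* Elements of Lebesgue and Sobolev spaces on an interval S are represented by functions
   real => real; only their values almost everywhere on S matter. *)

definition Linf_norm :: "real set \<Rightarrow> (real \<Rightarrow> real) \<Rightarrow> ereal" where
  "Linf_norm S f = esssup (lebesgue_on S) (\<lambda>x. ereal \<bar>f x\<bar>)"

definition in_Linf :: "real set \<Rightarrow> (real \<Rightarrow> real) \<Rightarrow> bool" where
  "in_Linf S f \<longleftrightarrow> f \<in> borel_measurable (lebesgue_on S) \<and> Linf_norm S f < \<infinity>"

definition in_L2 :: "real set \<Rightarrow> (real \<Rightarrow> real) \<Rightarrow> bool" where
  "in_L2 S f \<longleftrightarrow> f \<in> borel_measurable (lebesgue_on S) \<and> integrable (lebesgue_on S) (\<lambda>x. (f x)\<^sup>2)"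

(* C_c^infinity(S), each test function being extended by zero to the whole line *)
definition test_function :: "real set \<Rightarrow> (real \<Rightarrow> real) \<Rightarrow> bool" where
  "test_function S \<phi> \<longleftrightarrow>
     (\<forall>k x. (deriv ^^ k) \<phi> field_differentiable (at x)) \<and>
     compact (closure {x. \<phi> x \<noteq> 0}) \<and> closure {x. \<phi> x \<noteq> 0} \<subseteq> S"

definition has_weak_derivative :: "real set \<Rightarrow> (real \<Rightarrow> real) \<Rightarrow> (real \<Rightarrow> real) \<Rightarrow> bool" where
  "has_weak_derivative S u v \<longleftrightarrow>
     (\<forall>\<phi>. test_function S \<phi> \<longrightarrow>
        (LINT x|lebesgue_on S. u x * deriv \<phi> x) = - (LINT x|lebesgue_on S. v x * \<phi> x))"

(* u lies in H^1(S) and v is its weak derivative *)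
definition H1_with_derivative :: "real set \<Rightarrow> (real \<Rightarrow> real) \<Rightarrow> (real \<Rightarrow> real) \<Rightarrow> bool" where
  "H1_with_derivative S u v \<longleftrightarrow> in_L2 S u \<and> in_L2 S v \<and> has_weak_derivative S u v"

(* Weak form of u'' + a u = 0 on (0,L), u'(0) = u'(L) = 0. The variations range over all
   of H^1(0,L), not only over those vanishing at the endpoints: this encodes the Neumann
   conditions. *)
definition neumann_weak_solution :: "real \<Rightarrow> (real \<Rightarrow> real) \<Rightarrow> (real \<Rightarrow> real) \<Rightarrow> bool" where
  "neumann_weak_solution L a u \<longleftrightarrow>
     (\<exists>u'. H1_with_derivative {0<..<L} u u' \<and>
        (\<forall>\<phi> \<phi>'. H1_with_derivative {0<..<L} \<phi> \<phi>' \<longrightarrow>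
           (LINT x|lebesgue_on {0<..<L}. u' x * \<phi>' x) =
           (LINT x|lebesgue_on {0<..<L}. a x * u x * \<phi> x)))"

(* the relation c \<prec> d on (0,L) *)
definition prec_ae :: "real \<Rightarrow> (real \<Rightarrow> real) \<Rightarrow> (real \<Rightarrow> real) \<Rightarrow> bool" where
  "prec_ae L c d \<longleftrightarrow>
     (AE x in lebesgue_on {0..L}. c x \<le> d x) \<and>
     emeasure (lebesgue_on {0..L}) {x \<in> {0..L}. c x < d x} > 0"

definition neumann_eigenvalue :: "real \<Rightarrow> nat \<Rightarrow> real" where
  "neumann_eigenvalue L n = (real n)\<^sup>2 * pi\<^sup>2 / L\<^sup>2"

end

theory Submission
  imports Defs "HOL-Real_Asymp.Real_Asymp"
begin

text \<open>Let \<open>Q(f)\<close> be the integral of \<open>f'\<^sup>2 - a f\<^sup>2\<close> over \<open>(0,L)\<close>. If \<open>u\<close> is a solution, then \<open>Q(\<psi> + \<beta> u) = Q(\<psi>)\<close> for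
all \<open>\<psi>\<close> in \<open>H\<^sup>1\<close>. The lower bound on \<open>a\<close> makes \<open>Q\<close> negative definite on the span of the \<open>n + 1\<close> modes
\<open>cos (k\<pi>x/L)\<close>, \<open>k \<le> n\<close>. The upper bound on \<open>a\<close>, with the Wirtinger inequality on each of the \<open>2n + 2\<close>
subintervals, makes \<open>Q\<close> nonnegative on functions vanishing at the \<open>n + 1\<close> points \<open>y\<^sub>1, y\<^sub>3, \<dots>\<close>. Some
nonzero combination of the modes and \<open>u\<close> (\<open>n + 2\<close> unknowns) vanishes at these points, and comparing
signs shows that it is a multiple of \<open>u\<close>. So \<open>u\<close> is an extremal of every Wirtinger inequality,
i.e. a quarter sine wave on each subinterval, which is impossible where \<open>a\<close> is not the extremal
constant unless \<open>u\<close> vanishes there. As \<open>u\<close> is continuously differentiable, the zero Cauchy data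
propagate through all nodes.\<close>

section \<open>Smooth bump functions\<close>

text \<open>Smoothness in \<open>test_function\<close> quantifies over iterated derivatives;
  recursion on the order lets closure under sums, products and affine substitutions go by
  induction.\<close>

fun times_differentiable :: "nat \<Rightarrow> (real \<Rightarrow> real) \<Rightarrow> bool" where
  "times_differentiable 0 f \<longleftrightarrow> True"
| "times_differentiable (Suc n) f \<longleftrightarrow>
     (\<forall>x. f field_differentiable (at x)) \<and> times_differentiable n (deriv f)"

lemma times_differentiable_iff:
  "times_differentiable n f \<longleftrightarrow> (\<forall>k<n. \<forall>x. (deriv ^^ k) f field_differentiable (at x))"
proof (induction n arbitrary: f)
  case (Suc n)
  show ?case
    unfolding times_differentiable.simps Suc.IH All_less_Suc2 funpow_Suc_right by simp
qed simp

lemma times_differentiable_Suc_imp: "times_differentiable (Suc n) f \<Longrightarrow> times_differentiable n f"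
  unfolding times_differentiable_iff by simp

lemma times_differentiable_const [simp]: "times_differentiable n (\<lambda>x. c)"
  by (induction n arbitrary: c) (auto simp: deriv_const)

lemma times_differentiable_add:
  "times_differentiable n f \<Longrightarrow> times_differentiable n g \<Longrightarrow> times_differentiable n (\<lambda>x. f x + g x)"
proof (induction n arbitrary: f g)
  case (Suc n)
  have "deriv (\<lambda>x. f x + g x) = (\<lambda>x. deriv f x + deriv g x)"
    using Suc.prems by (auto simp: fun_eq_iff)
  then show ?case
    using Suc by (auto intro!: derivative_intros field_differentiable_add)
qed simp

lemma times_differentiable_mult:
  "times_differentiable n f \<Longrightarrow> times_differentiable n g \<Longrightarrow> times_differentiable n (\<lambda>x. f x * g x)"
proof (induction n arbitrary: f g)
  case (Suc n)
  have "deriv (\<lambda>x. f x * g x) = (\<lambda>x. f x * deriv g x + deriv f x * g x)"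
    using Suc.prems by (auto simp: fun_eq_iff)
  moreover have "times_differentiable n f" "times_differentiable n g"
    using Suc.prems times_differentiable_Suc_imp by blast+
  ultimately show ?case
    using Suc by (auto intro!: field_differentiable_mult times_differentiable_add)
qed simp

lemma times_differentiable_affine:
  "times_differentiable n f \<Longrightarrow> times_differentiable n (\<lambda>x. f (m * x + c))"
proof (induction n arbitrary: f)
  case (Suc n)
  have D: "((\<lambda>x. f (m * x + c)) has_field_derivative m * deriv f (m * x + c)) (at x)" for x
  proof -
    have "(f has_field_derivative deriv f (m * x + c)) (at (m * x + c))"
      using Suc.prems by (auto simp: field_differentiable_derivI)
    then show ?thesis
      by (rule DERIV_chain2[where f=f, THEN DERIV_cong]) (auto intro!: derivative_eq_intros)
  qed
  then have "deriv (\<lambda>x. f (m * x + c)) = (\<lambda>x. m * deriv f (m * x + c))"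
    by (auto simp: fun_eq_iff intro: DERIV_imp_deriv)
  then show ?case
    using D Suc by (auto intro!: times_differentiable_mult simp: field_differentiable_def)
qed simp

text \<open>Allowing a polynomial factor in \<open>1 / t\<close> makes this family closed under differentiation.\<close>

definition flat :: "real poly \<Rightarrow> real \<Rightarrow> real" where
  "flat p t = (if t > 0 then poly p (1 / t) * exp (- 1 / t) else 0)"

lemma poly_times_exp_minus_tendsto_0:
  fixes p :: "real poly"
  shows "((\<lambda>s. poly p s * exp (- s)) \<longlongrightarrow> 0) at_top"
proof -
  have "((\<lambda>s::real. coeff p i * (s ^ i / exp s)) \<longlongrightarrow> 0) at_top" for i
    by (rule tendsto_mult_right_zero[OF tendsto_power_div_exp_0])
  then have "((\<lambda>s::real. \<Sum>i\<le>degree p. coeff p i * (s ^ i / exp s)) \<longlongrightarrow> 0) at_top"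
    by (intro tendsto_null_sum) auto
  then show ?thesis
    by (simp add: poly_altdef sum_distrib_right exp_minus divide_inverse mult.assoc)
qed

text \<open>From the right, \<open>s = 1 / t\<close> turns the claim into the decay of a polynomial
  times \<open>exp (- s)\<close> at infinity; from the left the function is zero.\<close>

lemma flat_tendsto_0: "(flat p \<longlongrightarrow> 0) (at 0)"
proof -
  have "((\<lambda>t. poly p (inverse t) * exp (- inverse t)) \<longlongrightarrow> 0) (at_right 0)"
    by (rule filterlim_compose[OF poly_times_exp_minus_tendsto_0 filterlim_inverse_at_top_right])
  moreover have "eventually (\<lambda>t. poly p (inverse t) * exp (- inverse t) = flat p t) (at_right 0)"
    by (simp add: eventually_at_filter flat_def divide_inverse)
  ultimately have "(flat p \<longlongrightarrow> 0) (at_right 0)"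
    using Lim_transform_eventually by blast
  moreover have "(flat p \<longlongrightarrow> 0) (at_left 0)"
    by (rule Lim_transform_eventually[OF tendsto_const]) (simp add: eventually_at_filter flat_def)
  ultimately show ?thesis
    by (simp add: filterlim_split_at)
qed

text \<open>For \<open>t > 0\<close> the chain rule yields \<open>p - pderiv p\<close> at
  \<open>1 / t\<close> times the square of \<open>1 / t\<close>, which the factor
  \<open>[:0, 0, 1:]\<close> absorbs.\<close>

lemma flat_has_derivative:
  "(flat p has_field_derivative flat ([:0, 0, 1:] * (p - pderiv p)) t) (at t)"
proof -
  consider "t > 0" | "t < 0" | "t = 0" by linarith
  then show ?thesis
  proof cases
    case 1
    have "((\<lambda>t. poly p (1 / t) * exp (- 1 / t)) has_field_derivative
        flat ([:0, 0, 1:] * (p - pderiv p)) t) (at t)"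
      using 1 by (auto intro!: derivative_eq_intros DERIV_chain2[OF poly_DERIV]
          simp: flat_def field_simps)
    then show ?thesis
      by (rule has_field_derivative_transform_within[where d = t]) (use 1 in \<open>auto simp: flat_def dist_real_def\<close>)
  next
    case 2
    have "((\<lambda>t. 0) has_field_derivative flat ([:0, 0, 1:] * (p - pderiv p)) t) (at t)"
      using 2 by (simp add: flat_def)
    then show ?thesis
      by (rule has_field_derivative_transform_within[where d = "- t"])
        (use 2 in \<open>auto simp: flat_def dist_real_def\<close>)
  next
    case 3
    \<comment> \<open>Dividing by \<open>h\<close> multiplies \<open>p\<close> by its variable, so
      the difference quotient at 0 is again a flat function and tends to 0.\<close>
    have "(\<lambda>h. (flat p (0 + h) - flat p 0) / h) = flat (pCons 0 p)"
      by (auto simp: fun_eq_iff flat_def)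
    moreover have "flat ([:0, 0, 1:] * (p - pderiv p)) 0 = 0"
      by (simp add: flat_def)
    ultimately show ?thesis
      using 3 flat_tendsto_0[of "pCons 0 p"] by (simp only: DERIV_def)
  qed
qed

lemma times_differentiable_flat: "times_differentiable n (flat p)"
proof (induction n arbitrary: p)
  case (Suc n)
  have "deriv (flat p) = flat ([:0, 0, 1:] * (p - pderiv p))"
    by (rule ext) (rule DERIV_imp_deriv[OF flat_has_derivative])
  then show ?case
    using Suc flat_has_derivative[of p] unfolding times_differentiable.simps field_differentiable_def
    by metis
qed simp

text \<open>The arguments are \<open>k (x - c) - 1\<close> and \<open>k (r - x) - 1\<close>. The
  shift by 1 keeps the support inside \<open>[c + 1/k, r - 1/k]\<close>, a compact part of
  \<open>(c, r)\<close>, while the scaling by \<open>k\<close> drives the values inside to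
  1.\<close>

definition bump :: "real \<Rightarrow> real \<Rightarrow> nat \<Rightarrow> real \<Rightarrow> real" where
  "bump c r k x = flat 1 (real k * x + (- real k * c - 1)) * flat 1 (- real k * x + (real k * r - 1))"

lemma times_differentiable_bump: "times_differentiable n (bump c r k)"
  unfolding bump_def[abs_def]
  by (intro times_differentiable_mult times_differentiable_affine times_differentiable_flat)

lemma bump_nonneg: "0 \<le> bump c r k x" and bump_le_1: "bump c r k x \<le> 1"
  unfolding bump_def flat_def by (auto intro!: mult_le_one)

lemma bump_eq_0:
  assumes "k > 0" "x \<le> c + 1 / k \<or> r - 1 / k \<le> x"
  shows "bump c r k x = 0"
  using assms unfolding bump_def flat_def by (auto simp: field_simps)

lemma bump_pos:
  assumes "k > 0" "c + 1 / k < x" "x < r - 1 / k"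
  shows "bump c r k x > 0"
  using assms unfolding bump_def flat_def by (auto simp: field_simps)

lemma flat_one_tendsto_1: "(flat 1 \<longlongrightarrow> 1) at_top"
proof -
  have "((\<lambda>t::real. exp (- inverse t)) \<longlongrightarrow> exp (- 0)) at_top"
    by (intro tendsto_intros tendsto_inverse_0_at_top filterlim_ident)
  moreover have "eventually (\<lambda>t. exp (- inverse t) = flat 1 t) at_top"
    using eventually_gt_at_top[of 0] by eventually_elim (simp add: flat_def divide_inverse)
  ultimately show ?thesis
    using Lim_transform_eventually by fastforce
qed

text \<open>Inside \<open>(c, r)\<close> both arguments of \<open>flat 1\<close> grow without bound,
  and \<open>flat 1\<close> tends to 1 there; outside, the bump is zero for every positive
  \<open>k\<close>.\<close>

lemma bump_tendsto: "(\<lambda>k. bump c r k x) \<longlonglongrightarrow> indicator {c<..<r} x"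
proof (cases "c < x \<and> x < r")
  case True
  have lin: "filterlim (\<lambda>k. real k * d - 1) at_top sequentially" if "d > 0" for d
    using that by real_asymp
  have "(\<lambda>k. flat 1 (real k * (x - c) - 1) * flat 1 (real k * (r - x) - 1)) \<longlonglongrightarrow> 1 * 1"
    using True by (intro tendsto_mult filterlim_compose[OF flat_one_tendsto_1] lin) auto
  then show ?thesis
    using True by (simp add: bump_def algebra_simps)
next
  case False
  have zero: "bump c r k x = 0" if "k > 0" for k
    using that
  proof (rule bump_eq_0)
    have "1 / real k > 0"
      using that by simp
    then show "x \<le> c + 1 / k \<or> r - 1 / k \<le> x"
      using False by linarith
  qed
  have "eventually (\<lambda>k. bump c r k x = 0) sequentially"
    using eventually_gt_at_top[of 0] by eventually_elim (rule zero)
  then show ?thesis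
    using False by (auto intro: tendsto_eventually)
qed

section \<open>Weak derivatives on an interval\<close>

text \<open>Rays form an intersection-stable generator of the Borel sets, so a Dynkin argument
  extends the vanishing to all Borel sets, and null sets extend it to all Lebesgue sets. Uniqueness
  of densities concludes.\<close>

lemma AE_zero_if_integral_rays_zero:
  fixes g :: "real \<Rightarrow> real"
  assumes g: "integrable lebesgue g"
    and rays: "\<And>c. (LINT x:{c<..}|lebesgue. g x) = 0"
  shows "AE x in lebesgue. g x = 0"
proof -
  have si: "set_integrable lebesgue A g" if "A \<in> sets lebesgue" for A
    using integrable_mult_indicator[OF that g] by (simp add: set_integrable_def)
  \<comment> \<open>The complement case below needs the integral over the whole line, the limit of
    those over the rays from \<open>- n\<close>.\<close>
  have total: "(LINT x:UNIV|lebesgue. g x) = 0"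
  proof -
    have "(\<lambda>n. LINT x:{- real n<..}|lebesgue. g x) \<longlonglongrightarrow> (LINT x:(\<Union>n. {- real n<..})|lebesgue. g x)"
      by (rule set_integral_cont_up) (auto simp: incseq_def intro!: si)
    moreover have "(\<Union>n. {- real n<..}) = UNIV"
      using reals_Archimedean2[of "- x" for x] by (auto simp: minus_less_iff)
    ultimately show ?thesis
      using LIMSEQ_unique[OF _ tendsto_const] by (simp add: rays)
  qed
  have borel: "(LINT x:A|lebesgue. g x) = 0" if "A \<in> sets borel" for A
  proof -
    have "Int_stable (range (\<lambda>c::real. {c<..}))"
      by (auto simp: Int_stable_def lessThan_Int_lessThan greaterThan_Int_greaterThan)
    moreover have "range (\<lambda>c::real. {c<..}) \<subseteq> Pow UNIV"
      by simp
    moreover have gen: "sets borel = sigma_sets UNIV (range (\<lambda>c::real. {c<..}))"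
      unfolding borel_Ioi by auto
    have "A \<in> sigma_sets UNIV (range (\<lambda>c::real. {c<..}))"
      using that gen by simp
    ultimately show ?thesis
    proof (induction rule: sigma_sets_induct_disjoint)
      case (compl A)
      then have A: "A \<in> sets lebesgue" "- A \<in> sets lebesgue"
        using gen sets_completionI_sets[of _ lborel] by (auto intro: borel_comp)
      have "(LINT x:A \<union> - A|lebesgue. g x) = (LINT x:A|lebesgue. g x) + (LINT x:- A|lebesgue. g x)"
        using A by (intro set_integral_Un si) auto
      with total compl show ?case
        by (simp add: Compl_eq_Diff_UNIV Un_Diff_cancel)
    next
      case (union A)
      have "A i \<in> sets lebesgue" for i
        using union gen sets_completionI_sets[of _ lborel] by auto
      then have "(LINT x:(\<Union>i. A i)|lebesgue. g x) = (\<Sum>i. LINT x:A i|lebesgue. g x)"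
        using union by (intro lebesgue_integral_countable_add si) (auto simp: disjoint_family_on_def)
      with union show ?case by simp
    qed (auto simp: rays, simp add: set_lebesgue_integral_def)
  qed
  show ?thesis
  proof (rule density_unique_real[OF g integrable_zero])
    fix A :: "real set"
    assume "A \<in> sets lebesgue"
    then obtain S N N' where A: "A = S \<union> N" "N \<subseteq> N'" "N' \<in> null_sets lborel" "S \<in> sets lborel"
      by (rule sets_completionE)
    have "N \<in> null_sets lebesgue"
      using A by (simp add: null_sets_completionI null_sets_completion_subset)
    then have "AE x in lebesgue. x \<notin> N"
      by (rule AE_not_in)
    then have "AE x in lebesgue. indicator A x *\<^sub>R g x = indicator S x *\<^sub>R g x"
      by eventually_elim (auto simp: A indicator_def)
    moreover have "S \<in> sets lebesgue"
      using A by (simp add: sets_completionI_sets)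
    ultimately have "(LINT x:A|lebesgue. g x) = (LINT x:S|lebesgue. g x)"
      unfolding set_lebesgue_integral_def using si \<open>A \<in> sets lebesgue\<close>
      by (intro integral_cong_AE) (auto simp: set_integrable_def)
    with A borel[of S] show "(LINT x:A|lebesgue. g x) = (LINT x:A|lebesgue. 0)" by simp
  qed
qed

text \<open>Zero mean is what makes the primitive compactly supported: beyond \<open>d\<close> it
  has accumulated the whole integral of \<open>\<eta>\<close>.\<close>

lemma test_function_primitive:
  assumes smooth: "\<And>n. times_differentiable n \<eta>"
    and supp: "\<And>x. x \<notin> {c..d} \<Longrightarrow> \<eta> x = 0"
    and "l < c" "d < r" "integral {c..d} \<eta> = 0"
  shows "\<exists>\<phi>. test_function {l<..<r} \<phi> \<and> deriv \<phi> = \<eta>"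
proof -
  \<comment> \<open>Starting at \<open>c - 1\<close> makes every \<open>x \<ge> c\<close> an
    interior point of the interval on which the fundamental theorem is applied.\<close>
  define \<phi> where "\<phi> x = integral {c - 1..x} \<eta>" for x
  have "\<eta> field_differentiable (at x)" for x
    using smooth[of 1] by simp
  then have cont: "continuous_on S \<eta>" for S
    by (meson continuous_at_imp_continuous_on field_differentiable_imp_continuous_at)
  have supp_\<phi>: "\<phi> x = 0" if "x \<notin> {c..d}" for x
  proof (cases "x < c")
    case True
    then have "integral {c - 1..x} \<eta> = integral {c - 1..x} (\<lambda>_. 0)"
      by (intro integral_cong supp) auto
    then show ?thesis
      by (simp add: \<phi>_def)
  next
    case False
    have "(\<eta> has_integral 0) {c..d}"
      using assms(5) integrable_continuous_real[OF cont] by (metis has_integral_integral)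
    then have "(\<eta> has_integral 0) {c - 1..x}"
      by (rule has_integral_on_superset) (use supp that False in auto)
    then show ?thesis
      by (simp add: \<phi>_def integral_unique)
  qed
  have D: "(\<phi> has_field_derivative \<eta> x) (at x)" for x
  proof (cases "x < c")
    case True
    have "((\<lambda>_. 0) has_field_derivative \<eta> x) (at x)"
      using True supp[of x] by simp
    then show ?thesis
      by (rule has_field_derivative_transform_within[where d = "c - x"])
        (use True in \<open>auto simp: dist_real_def intro!: supp_\<phi>\<close>)
  next
    case False
    have "(\<phi> has_field_derivative \<eta> x) (at x within {c - 1..x + 1})"
      unfolding \<phi>_def using False by (intro integral_has_real_derivative cont) auto
    then show ?thesis
      using False by (subst (asm) at_within_Icc_at) auto
  qed
  then have deriv: "deriv \<phi> = \<eta>"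
    by (auto simp: fun_eq_iff intro: DERIV_imp_deriv)
  have "times_differentiable n \<phi>" for n
    using times_differentiable_Suc_imp[of n \<phi>] D smooth deriv by (auto simp: field_differentiable_def)
  then have "(deriv ^^ k) \<phi> field_differentiable (at x)" for k x
    unfolding times_differentiable_iff by blast
  moreover have "closure {x. \<phi> x \<noteq> 0} \<subseteq> {c..d}"
    using supp_\<phi> by (intro closure_minimal) (blast, simp)
  moreover from this have "compact (closure {x. \<phi> x \<noteq> 0})"
    by (meson bounded_closed_interval bounded_subset closed_closure compact_eq_bounded_closed)
  ultimately have "test_function {l<..<r} \<phi>"
    using assms(3,4) unfolding test_function_def by fastforce
  with deriv show ?thesis by blast
qed

lemma continuous_on_bump: "continuous_on S (bump c r k)"
proof -
  have "bump c r k field_differentiable (at x)" for x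
    using times_differentiable_bump[of 1] by simp
  then show ?thesis
    by (meson continuous_at_imp_continuous_on field_differentiable_imp_continuous_at)
qed

lemma continuous_borel_measurable_lebesgue_on:
  fixes f :: "real \<Rightarrow> real"
  assumes "continuous_on UNIV f"
  shows "f \<in> borel_measurable (lebesgue_on S)"
  using borel_measurable_continuous_onI[OF assms]
  by (intro measurable_restrict_space1 measurable_completion) simp

lemma integrable_mult_bounded:
  fixes f g :: "'a \<Rightarrow> real"
  assumes "integrable M f" "g \<in> borel_measurable M" "AE x in M. \<bar>g x\<bar> \<le> B"
  shows "integrable M (\<lambda>x. f x * g x)"
proof (rule Bochner_Integration.integrable_bound)
  show "integrable M (\<lambda>x. B * f x)"
    using assms by simp
  show "AE x in M. norm (f x * g x) \<le> norm (B * f x)"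
    using assms(3)
  proof eventually_elim
    case (elim x)
    then have "\<bar>g x\<bar> * \<bar>f x\<bar> \<le> \<bar>B\<bar> * \<bar>f x\<bar>"
      by (intro mult_right_mono) auto
    then show ?case
      by (simp add: abs_mult mult.commute)
  qed
qed (use assms in auto)

lemma integrable_bump:
  assumes "integrable (lebesgue_on S) f"
  shows "integrable (lebesgue_on S) (\<lambda>x. f x * bump c r k x)"
  using assms bump_nonneg bump_le_1
  by (intro integrable_mult_bounded[where B = 1] continuous_borel_measurable_lebesgue_on
      continuous_on_bump) (auto simp: abs_of_nonneg)

lemma LINT_Ioo_eq_integral:
  fixes f :: "real \<Rightarrow> real"
  assumes "integrable (lebesgue_on {l<..<r}) f"
  shows "(LINT x|lebesgue_on {l<..<r}. f x) = integral {l..r} f"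
  using assms by (simp add: lebesgue_integral_eq_integral integral_open_interval_real)

text \<open>A bump minus a suitable multiple of a fixed reference bump has mean zero, hence is the
  derivative of a test function, and \<open>f\<close> is orthogonal to it. So \<open>f - m\<close>
  is orthogonal to all bumps, by dominated convergence to the indicators of all
  \<open>(c, r)\<close>, and thus zero almost everywhere.\<close>

theorem weak_derivative_zero_imp_constant:
  fixes f :: "real \<Rightarrow> real"
  assumes "l < r" and f: "integrable (lebesgue_on {l<..<r}) f"
    and weak: "has_weak_derivative {l<..<r} f (\<lambda>_. 0)"
  shows "\<exists>K. AE x in lebesgue_on {l<..<r}. f x = K"
proof -
  let ?M = "lebesgue_on {l<..<r}"
  \<comment> \<open>This choice leaves \<open>l + 1/k0 < r - 1/k0\<close>, so the reference bump is
    positive at the midpoint and has positive mass \<open>I0\<close>.\<close>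
  obtain k0 :: nat where k0: "2 / (r - l) < real k0"
    using reals_Archimedean2 by blast
  moreover have "2 / (r - l) > 0"
    using \<open>l < r\<close> by simp
  ultimately have "k0 > 0"
    by linarith
  with k0 \<open>l < r\<close> have k0': "k0 > 0" "2 / k0 < r - l"
    by (auto simp: field_simps)
  have const: "integrable ?M (\<lambda>_. C)" for C :: real
    by (simp add: finite_measure.integrable_const finite_measure_lebesgue_on)
  have bumpM: "integrable ?M (bump c r k)" for c k
    using integrable_bump[OF const[of 1]] by simp
  define I0 where "I0 = (LINT x|?M. bump l r k0 x)"
  have "I0 > 0"
  proof -
    have I0: "I0 = integral {l..r} (bump l r k0)"
      unfolding I0_def by (rule LINT_Ioo_eq_integral[OF bumpM])
    have "bump l r k0 ((l + r) / 2) > 0"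
      using k0' by (intro bump_pos) (auto simp: field_simps)
    then have "I0 \<noteq> 0"
      unfolding I0 using \<open>l < r\<close>
      by (subst integral_eq_0_iff[OF continuous_on_bump])
        (auto simp: bump_nonneg intro!: bexI[of _ "(l + r) / 2"])
    moreover have "I0 \<ge> 0"
      unfolding I0_def by (simp add: bump_nonneg)
    ultimately show ?thesis by simp
  qed
  \<comment> \<open>If \<open>f\<close> is constant, testing against the reference bump shows that
    this is its value.\<close>
  define m where "m = (LINT x|?M. f x * bump l r k0 x) / I0"
  have orth: "(LINT x|?M. (f x - m) * bump c r k x) = 0" if "l \<le> c" "c < r" "k > 0" for c k
  proof -
    define z where "z = (LINT x|?M. bump c r k x) / I0"
    define \<eta> where "\<eta> x = bump c r k x + (- z) * bump l r k0 x" for x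
    \<comment> \<open>A common margin: both bumps vanish within distance \<open>e\<close> of
      \<open>l\<close> and of \<open>r\<close>.\<close>
    define e where "e = min (1 / real k) (1 / real k0)"
    have "e > 0" using that k0' by (auto simp: e_def)
    have supp: "\<eta> x = 0" if "x \<notin> {l + e..r - e}" for x
    proof -
      have "x \<le> c + 1 / k \<or> r - 1 / k \<le> x" "x \<le> l + 1 / k0 \<or> r - 1 / k0 \<le> x"
        using that \<open>l \<le> c\<close> unfolding e_def by auto
      then show ?thesis
        using \<open>k > 0\<close> k0' by (simp add: \<eta>_def bump_eq_0)
    qed
    have \<eta>: "integrable ?M \<eta>"
      unfolding \<eta>_def by (intro Bochner_Integration.integrable_add integrable_mult_right bumpM)
    have "integral {l + e..r - e} \<eta> = integral {l..r} \<eta>"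
    proof -
      have "(\<lambda>x. if x \<in> {l + e..r - e} then \<eta> x else 0) = \<eta>"
        using supp by auto
      moreover have "{l..r} \<inter> {l + e..r - e} = {l + e..r - e}"
        using \<open>e > 0\<close> by auto
      ultimately show ?thesis
        using integral_restrict_Int[of "{l..r}" "{l + e..r - e}" \<eta>] by (simp only: Int_commute)
    qed
    also have "\<dots> = (LINT x|?M. \<eta> x)"
      by (rule LINT_Ioo_eq_integral[OF \<eta>, symmetric])
    also have "\<dots> = 0"
      using \<open>I0 > 0\<close> bumpM unfolding \<eta>_def by (simp add: z_def I0_def)
    finally have "integral {l + e..r - e} \<eta> = 0" .
    moreover have "times_differentiable n \<eta>" for n
      unfolding \<eta>_def by (intro times_differentiable_add times_differentiable_mult times_differentiable_bump) simp
    ultimately obtain \<phi> where \<phi>: "test_function {l<..<r} \<phi>" "deriv \<phi> = \<eta>"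
      using test_function_primitive[of \<eta> "l + e" "r - e" l r] supp \<open>e > 0\<close> by auto
    have "(LINT x|?M. f x * \<eta> x) = 0"
      using weak \<phi> unfolding has_weak_derivative_def by auto
    then have "(LINT x|?M. f x * bump c r k x) = z * (LINT x|?M. f x * bump l r k0 x)"
      using integrable_bump[OF f] by (simp add: \<eta>_def algebra_simps)
    also have "\<dots> = m * (LINT x|?M. bump c r k x)"
      by (simp add: z_def m_def)
    finally show ?thesis
      using integrable_bump[OF f] bumpM by (simp add: algebra_simps)
  qed
  define g where "g x = indicator {l<..<r} x * (f x - m)" for x
  have fm: "integrable ?M (\<lambda>x. f x - m)"
    by (intro Bochner_Integration.integrable_diff f const)
  then have g: "integrable lebesgue g"
    unfolding g_def by (simp add: integrable_restrict_space)
  have tail: "(LINT x|?M. (f x - m) * indicator {c<..<r} x) = 0" if "l \<le> c" "c < r" for c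
  proof -
    have "(\<lambda>k. LINT x|?M. (f x - m) * bump c r k x) \<longlonglongrightarrow> (LINT x|?M. (f x - m) * indicator {c<..<r} x)"
    proof (rule integral_dominated_convergence[where w = "\<lambda>x. \<bar>f x - m\<bar>"])
      show "AE x in ?M. (\<lambda>k. (f x - m) * bump c r k x) \<longlonglongrightarrow> (f x - m) * indicator {c<..<r} x"
        by (intro AE_I2 tendsto_mult tendsto_const bump_tendsto)
      show "AE x in ?M. norm ((f x - m) * bump c r k x) \<le> \<bar>f x - m\<bar>" for k
        using bump_nonneg[of c r k] bump_le_1[of c r k]
        by (intro AE_I2) (simp add: abs_mult mult_left_le)
      have "indicat_real {c<..<r} \<in> borel_measurable ?M"
        by (intro measurable_restrict_space1 measurable_completion) simp
      then show "(\<lambda>x. (f x - m) * indicator {c<..<r} x) \<in> borel_measurable ?M"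
        by (intro borel_measurable_times borel_measurable_integrable[OF fm])
    qed (use fm integrable_bump[OF fm] in simp_all)
    moreover have "eventually (\<lambda>k. (LINT x|?M. (f x - m) * bump c r k x) = 0) sequentially"
      using eventually_gt_at_top[of 0] by eventually_elim (rule orth[OF that])
    ultimately show ?thesis
      by (rule LIMSEQ_unique[OF _ tendsto_eventually])
  qed
  have "AE x in lebesgue. g x = 0"
  proof (rule AE_zero_if_integral_rays_zero[OF g])
    fix c
    \<comment> \<open>Since \<open>g\<close> vanishes off \<open>(l, r)\<close>, the ray contributes
      only beyond \<open>max l c\<close>, and nothing if that point is not below
      \<open>r\<close>.\<close>
    have "(LINT x:{c<..}|lebesgue. g x) =
        (LINT x|lebesgue. indicator {l<..<r} x *\<^sub>R ((f x - m) * indicator {max l c<..<r} x))"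
      unfolding set_lebesgue_integral_def
      by (rule Bochner_Integration.integral_cong) (auto simp: g_def indicator_def)
    also have "\<dots> = (LINT x|?M. (f x - m) * indicator {max l c<..<r} x)"
      by (rule integral_restrict_space[symmetric]) simp
    also have "\<dots> = 0"
    proof (cases "max l c < r")
      case True
      then show ?thesis
        by (intro tail) auto
    next
      case False
      then have "{max l c<..<r} = {}" by auto
      then show ?thesis by simp
    qed
    finally show "(LINT x:{c<..}|lebesgue. g x) = 0" .
  qed
  then have "AE x in lebesgue. x \<in> {l<..<r} \<longrightarrow> f x = m"
    by eventually_elim (auto simp: g_def)
  then have "AE x in ?M. f x = m"
    by (simp add: AE_restrict_space_iff)
  then show ?thesis ..
qed

section \<open>Integration on intervals and against test functions\<close>

lemma integrable_lebesgue_on_Ioo_iff: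
  fixes f :: "real \<Rightarrow> real"
  shows "integrable (lebesgue_on {l<..<r}) f \<longleftrightarrow> integrable (lebesgue_on {l..r}) f"
proof -
  have "integrable (lebesgue_on S) f \<longleftrightarrow> f absolutely_integrable_on S" if "S \<in> sets lebesgue" for S
    using that by (simp add: integrable_restrict_space set_integrable_def)
  then show ?thesis
    by (simp add: absolutely_integrable_on_Icc_iff_Ioo)
qed

lemma continuous_on_imp_integrable_Ioo:
  fixes f :: "real \<Rightarrow> real"
  assumes "continuous_on {l..r} f"
  shows "integrable (lebesgue_on {l<..<r}) f"
  using assms by (simp add: integrable_lebesgue_on_Ioo_iff continuous_imp_integrable_real)

lemma AE_lebesgue_on_iff_negligible:
  assumes "S \<in> sets lebesgue"
  shows "(AE x in lebesgue_on S. P x) \<longleftrightarrow> negligible {x \<in> S. \<not> P x}"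
proof -
  have "(AE x in lebesgue. x \<in> S \<longrightarrow> P x) \<longleftrightarrow> (\<exists>N\<in>null_sets lebesgue. {x \<in> S. \<not> P x} \<subseteq> N)"
    by (simp add: eventually_ae_filter)
  also have "\<dots> \<longleftrightarrow> negligible {x \<in> S. \<not> P x}"
    by (meson negligible_iff_null_sets negligible_subset order_refl)
  finally show ?thesis
    using assms by (simp add: AE_restrict_space_iff)
qed

lemma integral_cong_AE_Ioo:
  fixes f g :: "real \<Rightarrow> real"
  assumes "AE x in lebesgue_on {l<..<r}. f x = g x" and "{c..d} \<subseteq> {l..r}"
  shows "integral {c..d} f = integral {c..d} g"
proof (rule integral_spike)
  have "negligible {x \<in> {l<..<r}. f x \<noteq> g x}"
    using assms(1) by (simp add: AE_lebesgue_on_iff_negligible)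
  then show "negligible ({x \<in> {l<..<r}. f x \<noteq> g x} \<union> {l, r})"
    by (rule negligible_Un) simp
  show "g x = f x" if "x \<in> {c..d} - ({x \<in> {l<..<r}. f x \<noteq> g x} \<union> {l, r})" for x
    using that assms(2) by (auto simp: subset_iff less_le)
qed

lemma test_functionD:
  assumes "test_function S \<phi>"
  shows "(\<phi> has_field_derivative deriv \<phi> x) (at x)"
    and "continuous_on A \<phi>" and "continuous_on A (deriv \<phi>)"
    and "x \<notin> S \<Longrightarrow> \<phi> x = 0"
proof -
  have d: "(deriv ^^ k) \<phi> field_differentiable (at x)" for k x
    using assms unfolding test_function_def by blast
  show "(\<phi> has_field_derivative deriv \<phi> x) (at x)"
    using d[of 0 x] by (simp add: field_differentiable_derivI)
  show "continuous_on A \<phi>"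
    using d[of 0] by (simp add: continuous_at_imp_continuous_on field_differentiable_imp_continuous_at)
  show "continuous_on A (deriv \<phi>)"
    using d[of 1] by (simp add: continuous_at_imp_continuous_on field_differentiable_imp_continuous_at)
  show "\<phi> x = 0" if "x \<notin> S"
    using assms that closure_subset[of "{x. \<phi> x \<noteq> 0}"] unfolding test_function_def by blast
qed

lemma test_function_integral_deriv:
  assumes "test_function {l<..<r} \<phi>" "l \<le> x" "x \<le> r"
  shows "integral {x..r} (deriv \<phi>) = - \<phi> x"
proof -
  have "(deriv \<phi> has_integral (\<phi> r - \<phi> x)) {x..r}"
    using assms test_functionD(1)[OF assms(1)]
    by (intro fundamental_theorem_of_calculus)
      (auto simp: has_real_derivative_iff_has_vector_derivative[symmetric] intro: has_field_derivative_at_within)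
  then show ?thesis
    using test_functionD(4)[OF assms(1), of r] by (simp add: integral_unique)
qed

text \<open>Integrals over varying subintervals become integrals over one fixed measure space, the
  form to which Fubini applies.\<close>

lemma integral_Icc_eq_LINT:
  fixes f :: "real \<Rightarrow> real"
  assumes f: "integrable (lebesgue_on {l<..<r}) f" and "l \<le> c" "d \<le> r"
  shows "integral {c..d} f = (LINT x|lebesgue_on {l<..<r}. indicator {c<..<d} x * f x)"
proof -
  have ind: "indicator {c<..<d} x *\<^sub>R (indicator {l<..<r} x *\<^sub>R f x) = indicator {c<..<d} x *\<^sub>R f x"
    "indicator {l<..<r} x *\<^sub>R (indicator {c<..<d} x * f x) = indicator {c<..<d} x *\<^sub>R f x" for x
    using assms by (auto simp: indicator_def)
  have "integrable lebesgue (\<lambda>x. indicator {c<..<d} x *\<^sub>R (indicator {l<..<r} x *\<^sub>R f x))"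
    by (rule integrable_mult_indicator) (use f in \<open>simp_all add: integrable_restrict_space\<close>)
  then have "integrable (lebesgue_on {c<..<d}) f"
    unfolding ind by (simp add: integrable_restrict_space)
  then have "integral {c..d} f = (LINT x|lebesgue_on {c<..<d}. f x)"
    by (rule LINT_Ioo_eq_integral[symmetric])
  also have "\<dots> = (LINT x|lebesgue. indicator {l<..<r} x *\<^sub>R (indicator {c<..<d} x * f x))"
    unfolding ind by (simp add: integral_restrict_space)
  also have "\<dots> = (LINT x|lebesgue_on {l<..<r}. indicator {c<..<d} x * f x)"
    by (rule integral_restrict_space[symmetric]) simp
  finally show ?thesis .
qed

text \<open>Fubini for \<open>v t * deriv \<phi> x\<close> on the triangle \<open>t < x\<close>:
  integrating first in \<open>t\<close> gives the primitive of \<open>v\<close>, first in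
  \<open>x\<close> gives \<open>- \<phi> t\<close>, because \<open>\<phi>\<close> vanishes at
  \<open>r\<close>.\<close>

lemma indefinite_integral_has_weak_derivative:
  assumes v: "integrable (lebesgue_on {l<..<r}) v"
  shows "has_weak_derivative {l<..<r} (\<lambda>x. integral {l..x} v) v"
  unfolding has_weak_derivative_def
proof (intro allI impI)
  fix \<phi> assume \<phi>: "test_function {l<..<r} \<phi>"
  let ?M = "lebesgue_on {l<..<r}"
  interpret finite_measure ?M
    by (rule finite_measure_lebesgue_on) simp
  interpret pair_sigma_finite ?M ?M
    by standard
  define F where "F t x = indicator {t<..<r} x * (v t * deriv \<phi> x)" for t x
  obtain B where B: "\<forall>x\<in>{l..r}. \<bar>deriv \<phi> x\<bar> \<le> B"
    using compact_imp_bounded[OF compact_continuous_image[OF test_functionD(3)[OF \<phi>] compact_Icc, of l r]]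
    by (auto simp: bounded_iff)
  have [measurable]: "v \<in> borel_measurable ?M" "deriv \<phi> \<in> borel_measurable ?M" "(\<lambda>x. x) \<in> borel_measurable ?M"
    using v continuous_borel_measurable_lebesgue_on[OF test_functionD(3)[OF \<phi>]]
      id_borel_measurable_lebesgue_on by (auto simp: id_def)
  have meas: "(\<lambda>p. F (fst p) (snd p)) \<in> borel_measurable (?M \<Otimes>\<^sub>M ?M)"
  proof -
    have "F t x = (if t < x \<and> x < r then v t * deriv \<phi> x else 0)" for t x
      by (simp add: F_def indicator_def)
    then show ?thesis by simp
  qed
  have dom: "integrable (?M \<Otimes>\<^sub>M ?M) (\<lambda>p. B * v (fst p))"
    using v by (intro Fubini_integrable) (auto simp: abs_mult)
  have bound: "norm (F (fst p) (snd p)) \<le> norm (B * v (fst p))" if "p \<in> space (?M \<Otimes>\<^sub>M ?M)" for p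
  proof -
    have "snd p \<in> {l..r}"
      using that by (auto simp: space_pair_measure)
    then have "\<bar>deriv \<phi> (snd p)\<bar> \<le> \<bar>B\<bar>"
      using B by fastforce
    then have "\<bar>v (fst p)\<bar> * \<bar>deriv \<phi> (snd p)\<bar> \<le> \<bar>v (fst p)\<bar> * \<bar>B\<bar>"
      by (rule mult_left_mono) simp
    then show ?thesis
      by (simp add: F_def indicator_def abs_mult mult.commute)
  qed
  have "integrable (?M \<Otimes>\<^sub>M ?M) (\<lambda>p. F (fst p) (snd p))"
    by (intro Bochner_Integration.integrable_bound[OF dom meas] AE_I2 bound)
  then have Fub: "(LINT x|?M. LINT t|?M. F t x) = (LINT t|?M. LINT x|?M. F t x)"
    by (intro Fubini_integral) (simp add: case_prod_beta')
  have "(LINT x|?M. LINT t|?M. F t x) = (LINT x|?M. integral {l..x} v * deriv \<phi> x)"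
  proof (rule Bochner_Integration.integral_cong)
    fix x assume "x \<in> space ?M"
    then have "(LINT t|?M. F t x) = (LINT t|?M. indicator {l<..<x} t * v t * deriv \<phi> x)"
      by (intro Bochner_Integration.integral_cong) (auto simp: F_def indicator_def)
    also have "\<dots> = integral {l..x} v * deriv \<phi> x"
      using \<open>x \<in> space ?M\<close> by (simp add: integral_Icc_eq_LINT[OF v])
    finally show "(LINT t|?M. F t x) = integral {l..x} v * deriv \<phi> x" .
  qed simp
  moreover have "(LINT t|?M. LINT x|?M. F t x) = (LINT t|?M. - (v t * \<phi> t))"
  proof (rule Bochner_Integration.integral_cong)
    fix t assume t: "t \<in> space ?M"
    have "(LINT x|?M. F t x) = v t * (LINT x|?M. indicator {t<..<r} x * deriv \<phi> x)"
      by (simp add: F_def mult.left_commute)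
    also have "(LINT x|?M. indicator {t<..<r} x * deriv \<phi> x) = integral {t..r} (deriv \<phi>)"
      using t by (intro integral_Icc_eq_LINT[symmetric] continuous_on_imp_integrable_Ioo test_functionD(3)[OF \<phi>]) auto
    also have "\<dots> = - \<phi> t"
      using t by (intro test_function_integral_deriv[OF \<phi>]) auto
    finally show "(LINT x|?M. F t x) = - (v t * \<phi> t)" by simp
  qed simp
  ultimately show "(LINT x|?M. integral {l..x} v * deriv \<phi> x) = - (LINT x|?M. v x * \<phi> x)"
    using Fub by simp
qed

lemma continuous_on_borel_measurable_Ioo:
  fixes f :: "real \<Rightarrow> real"
  assumes "continuous_on {l..r} f"
  shows "f \<in> borel_measurable (lebesgue_on {l<..<r})"
  using continuous_on_imp_integrable_Ioo[OF assms] by (rule borel_measurable_integrable)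

lemma integrable_mult_continuous_Ioo:
  fixes f g :: "real \<Rightarrow> real"
  assumes f: "integrable (lebesgue_on {l<..<r}) f" and g: "continuous_on {l..r} g"
  shows "integrable (lebesgue_on {l<..<r}) (\<lambda>x. f x * g x)"
proof -
  obtain B where "\<forall>x\<in>{l..r}. \<bar>g x\<bar> \<le> B"
    using compact_imp_bounded[OF compact_continuous_image[OF g compact_Icc]] by (auto simp: bounded_iff)
  then show ?thesis
    by (intro integrable_mult_bounded[OF f continuous_on_borel_measurable_Ioo[OF g]] AE_I2) auto
qed

lemma in_L2_imp_integrable:
  assumes "in_L2 {l<..<r} u"
  shows "integrable (lebesgue_on {l<..<r}) u"
proof (rule Bochner_Integration.integrable_bound)
  show "integrable (lebesgue_on {l<..<r}) (\<lambda>x. 1 + (u x)\<^sup>2)"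
    using assms continuous_on_imp_integrable_Ioo[OF continuous_on_const]
    unfolding in_L2_def by (intro Bochner_Integration.integrable_add) auto
  have "\<bar>t\<bar> \<le> 1 + t\<^sup>2" for t :: real
    using zero_le_power2[of "\<bar>t\<bar> - 1"] by (auto simp: power2_eq_square algebra_simps abs_if split: if_splits)
  then show "AE x in lebesgue_on {l<..<r}. norm (u x) \<le> norm (1 + (u x)\<^sup>2)"
    by (intro AE_I2) (simp add: abs_of_nonneg)
qed (use assms in \<open>auto simp: in_L2_def\<close>)

lemma continuous_imp_in_L2:
  assumes "continuous_on {l..r} f"
  shows "in_L2 {l<..<r} f"
  unfolding in_L2_def
  using assms by (auto intro!: continuous_on_borel_measurable_Ioo continuous_on_imp_integrable_Ioo continuous_intros)

lemma LINT_test_function_deriv: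
  assumes "test_function {l<..<r} \<phi>" "l < r"
  shows "(LINT x|lebesgue_on {l<..<r}. deriv \<phi> x) = 0"
proof -
  have "(LINT x|lebesgue_on {l<..<r}. deriv \<phi> x) = integral {l..r} (deriv \<phi>)"
    by (intro LINT_Ioo_eq_integral continuous_on_imp_integrable_Ioo test_functionD[OF assms(1)])
  also have "\<dots> = - \<phi> l"
    using assms by (intro test_function_integral_deriv) auto
  finally show ?thesis
    using test_functionD(4)[OF assms(1), of l] by simp
qed

lemma integrable_imp_continuous_on_integral:
  fixes v :: "real \<Rightarrow> real"
  assumes "integrable (lebesgue_on {l<..<r}) v"
  shows "continuous_on {l..r} (\<lambda>x. integral {l..x} v)"
  using assms by (intro indefinite_integral_continuous_1)
    (simp add: integrable_lebesgue_on_Ioo_iff integrable_on_lebesgue_on)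

section \<open>Representatives of H^1 functions and regularity of weak solutions\<close>

text \<open>\<open>u\<close> and the primitive of \<open>v\<close> share the weak derivative
  \<open>v\<close>, so their difference is constant by the du Bois-Reymond lemma.\<close>

lemma H1_representative:
  assumes "l < r" "H1_with_derivative {l<..<r} u v"
  shows "\<exists>K. AE x in lebesgue_on {l<..<r}. u x = K + integral {l..x} v"
proof -
  let ?M = "lebesgue_on {l<..<r}"
  let ?V = "\<lambda>x. integral {l..x} v"
  have u: "integrable ?M u" and v: "integrable ?M v" and weak: "has_weak_derivative {l<..<r} u v"
    using assms in_L2_imp_integrable unfolding H1_with_derivative_def by auto
  have V: "integrable ?M ?V"
    by (intro continuous_on_imp_integrable_Ioo integrable_imp_continuous_on_integral v)
  have "has_weak_derivative {l<..<r} (\<lambda>x. u x - ?V x) (\<lambda>_. 0)"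
    unfolding has_weak_derivative_def
  proof (intro allI impI)
    fix \<phi> assume \<phi>: "test_function {l<..<r} \<phi>"
    have "(LINT x|?M. u x * deriv \<phi> x) = (LINT x|?M. ?V x * deriv \<phi> x)"
      using weak indefinite_integral_has_weak_derivative[OF v] \<phi> unfolding has_weak_derivative_def by simp
    then show "(LINT x|?M. (u x - ?V x) * deriv \<phi> x) = - (LINT x|?M. 0 * \<phi> x)"
      using integrable_mult_continuous_Ioo[OF u test_functionD(3)[OF \<phi>]]
        integrable_mult_continuous_Ioo[OF V test_functionD(3)[OF \<phi>]]
      by (simp add: left_diff_distrib)
  qed
  then obtain K where "AE x in ?M. u x - ?V x = K"
    using weak_derivative_zero_imp_constant[OF \<open>l < r\<close> Bochner_Integration.integrable_diff[OF u V]] by blast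
  then have "AE x in ?M. u x = K + ?V x"
    by eventually_elim simp
  then show ?thesis ..
qed

text \<open>Makes functions that are continuously differentiable up to the boundary, with arbitrary
  boundary values, available as variations. It reduces to the primitive of \<open>f'\<close>, as the
  constant \<open>f l\<close> is orthogonal to \<open>deriv \<phi>\<close>.\<close>

lemma H1_with_derivative_C1:
  assumes "l < r"
    and D: "\<And>x. x \<in> {l..r} \<Longrightarrow> (f has_real_derivative f' x) (at x within {l..r})"
    and cont: "continuous_on {l..r} f'"
  shows "H1_with_derivative {l<..<r} f f'"
proof -
  let ?M = "lebesgue_on {l<..<r}"
  have f: "continuous_on {l..r} f"
    using D by (rule DERIV_continuous_on)
  have f': "integrable ?M f'"
    by (rule continuous_on_imp_integrable_Ioo[OF cont])
  have rep: "f x = f l + integral {l..x} f'" if "x \<in> {l..r}" for x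
  proof -
    have "(f' has_integral (f x - f l)) {l..x}"
      using that by (intro fundamental_theorem_of_calculus)
        (auto simp: has_real_derivative_iff_has_vector_derivative[symmetric] intro!: DERIV_subset[OF D])
    then show ?thesis
      by (simp add: integral_unique)
  qed
  have "has_weak_derivative {l<..<r} f f'"
    unfolding has_weak_derivative_def
  proof (intro allI impI)
    fix \<phi> assume \<phi>: "test_function {l<..<r} \<phi>"
    have i: "integrable ?M (\<lambda>x. integral {l..x} f' * deriv \<phi> x)" "integrable ?M (deriv \<phi>)"
      by (intro integrable_mult_continuous_Ioo continuous_on_imp_integrable_Ioo
          integrable_imp_continuous_on_integral f' test_functionD(3)[OF \<phi>])+
    have "(LINT x|?M. f x * deriv \<phi> x) = (LINT x|?M. f l * deriv \<phi> x + integral {l..x} f' * deriv \<phi> x)"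
    proof (rule Bochner_Integration.integral_cong)
      show "f x * deriv \<phi> x = f l * deriv \<phi> x + integral {l..x} f' * deriv \<phi> x" if "x \<in> space ?M" for x
        using that by (subst rep) (auto simp: distrib_right)
    qed simp
    also have "\<dots> = f l * (LINT x|?M. deriv \<phi> x) + (LINT x|?M. integral {l..x} f' * deriv \<phi> x)"
      using i by simp
    also have "\<dots> = - (LINT x|?M. f' x * \<phi> x)"
      using indefinite_integral_has_weak_derivative[OF f'] \<phi> LINT_test_function_deriv[OF \<phi> \<open>l < r\<close>]
      unfolding has_weak_derivative_def by simp
    finally show "(LINT x|?M. f x * deriv \<phi> x) = - (LINT x|?M. f' x * \<phi> x)" .
  qed
  then show ?thesis
    unfolding H1_with_derivative_def using f cont by (auto intro: continuous_imp_in_L2)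
qed

lemma in_Linf_bounded:
  assumes "in_Linf S a"
  obtains B where "AE x in lebesgue_on S. \<bar>a x\<bar> \<le> B" "B \<ge> 0"
proof -
  have "AE x in lebesgue_on S. ereal \<bar>a x\<bar> \<le> Linf_norm S a"
    unfolding Linf_norm_def by (rule esssup_AE)
  moreover have "Linf_norm S a \<noteq> \<infinity>"
    using assms unfolding in_Linf_def by auto
  ultimately have "AE x in lebesgue_on S. \<bar>a x\<bar> \<le> max 0 (real_of_ereal (Linf_norm S a))"
    by (cases "Linf_norm S a") (auto elim!: eventually_mono)
  then show ?thesis
    by (rule that) simp
qed

lemma in_Linf_imp_integrable:
  assumes "in_Linf {l<..<r} a"
  shows "integrable (lebesgue_on {l<..<r}) a"
proof -
  obtain B where "AE x in lebesgue_on {l<..<r}. \<bar>a x\<bar> \<le> B"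
    using in_Linf_bounded[OF assms] .
  then have "integrable (lebesgue_on {l<..<r}) (\<lambda>x. 1 * a x)"
    using assms by (intro integrable_mult_bounded continuous_on_imp_integrable_Ioo) (auto simp: in_Linf_def)
  then show ?thesis by simp
qed

text \<open>The equation bounds the weak derivative of \<open>u'\<close> in L^2, so
  \<open>u'\<close> has a continuous representative and \<open>u\<close> a continuously
  differentiable one. The Neumann conditions remain encoded in the weak identity, whose variations
  are free at the ends.\<close>

theorem neumann_weak_solution_regular:
  assumes L: "L > 0" and a: "in_Linf {0<..<L} a" and sol: "neumann_weak_solution L a u"
  obtains U V where "AE x in lebesgue_on {0<..<L}. u x = U x"
    and "\<And>x. x \<in> {0..L} \<Longrightarrow> (U has_real_derivative V x) (at x within {0..L})"
    and "continuous_on {0..L} V"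
    and "\<And>\<phi> \<phi>'. (\<And>x. x \<in> {0..L} \<Longrightarrow> (\<phi> has_real_derivative \<phi>' x) (at x within {0..L})) \<Longrightarrow>
           continuous_on {0..L} \<phi>' \<Longrightarrow>
           integral {0..L} (\<lambda>x. V x * \<phi>' x) = integral {0..L} (\<lambda>x. a x * (U x * \<phi> x))"
proof -
  let ?M = "lebesgue_on {0<..<L}"
  obtain u' where u': "H1_with_derivative {0<..<L} u u'"
    and weak: "\<And>\<phi> \<phi>'. H1_with_derivative {0<..<L} \<phi> \<phi>' \<Longrightarrow>
      (LINT x|?M. u' x * \<phi>' x) = (LINT x|?M. a x * u x * \<phi> x)"
    using sol unfolding neumann_weak_solution_def by blast
  obtain B where B: "AE x in ?M. \<bar>a x\<bar> \<le> B" "B \<ge> 0"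
    using in_Linf_bounded[OF a] .
  have a_meas: "a \<in> borel_measurable ?M"
    using a by (simp add: in_Linf_def)
  have int_a: "integrable ?M a"
    using a by (rule in_Linf_imp_integrable)
  define w where "w x = - (u x * a x)" for x
  have u: "in_L2 {0<..<L} u" "in_L2 {0<..<L} u'"
    using u' unfolding H1_with_derivative_def by auto
  have "in_L2 {0<..<L} w"
  proof -
    have "AE x in ?M. \<bar>(a x)\<^sup>2\<bar> \<le> B\<^sup>2"
      using B(1) by eventually_elim (simp add: abs_le_square_iff[symmetric] B(2))
    then have "integrable ?M (\<lambda>x. (u x)\<^sup>2 * (a x)\<^sup>2)"
      using u(1) a_meas by (intro integrable_mult_bounded[where B = "B\<^sup>2"]) (auto simp: in_L2_def)
    then show ?thesis
      using u(1) a_meas by (auto simp: in_L2_def w_def[abs_def] power_mult_distrib)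
  qed
  \<comment> \<open>Test functions are admissible variations, and on them the weak equation says
    exactly this.\<close>
  moreover have "has_weak_derivative {0<..<L} u' w"
    unfolding has_weak_derivative_def
  proof (intro allI impI)
    fix \<phi> assume \<phi>: "test_function {0<..<L} \<phi>"
    have "H1_with_derivative {0<..<L} \<phi> (deriv \<phi>)"
      using test_functionD[OF \<phi>] L by (intro H1_with_derivative_C1) (auto intro: has_field_derivative_at_within)
    from weak[OF this] show "(LINT x|?M. u' x * deriv \<phi> x) = - (LINT x|?M. w x * \<phi> x)"
      by (simp add: w_def mult.commute)
  qed
  ultimately have "H1_with_derivative {0<..<L} u' w"
    using u(2) by (simp add: H1_with_derivative_def)
  from H1_representative[OF L this] obtain K where
    K: "AE x in ?M. u' x = K + integral {0..x} w" by blast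
  define V where "V x = K + integral {0..x} w" for x
  have V: "AE x in ?M. u' x = V x"
    using K by (simp add: V_def)
  have contV: "continuous_on {0..L} V"
    unfolding V_def using \<open>in_L2 {0<..<L} w\<close>
    by (intro continuous_intros integrable_imp_continuous_on_integral in_L2_imp_integrable)
  obtain C where C: "AE x in ?M. u x = C + integral {0..x} u'"
    using H1_representative[OF L u'] by blast
  \<comment> \<open>Integrating the continuous \<open>V\<close> in place of \<open>u'\<close>
    changes no value and makes \<open>U\<close> differentiable at every point.\<close>
  define U where "U x = C + integral {0..x} V" for x
  have U: "AE x in ?M. u x = U x"
    using C
  proof (rule AE_mp, intro AE_I2 impI)
    fix x assume "x \<in> space ?M" "u x = C + integral {0..x} u'"
    moreover from this have "integral {0..x} u' = integral {0..x} V"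
      by (intro integral_cong_AE_Ioo[OF V]) auto
    ultimately show "u x = U x"
      by (simp add: U_def)
  qed
  have DU: "(U has_real_derivative V x) (at x within {0..L})" if "x \<in> {0..L}" for x
    unfolding U_def using integral_has_real_derivative[OF contV that]
    by (auto intro!: derivative_eq_intros)
  then have contU: "continuous_on {0..L} U"
    by (rule DERIV_continuous_on)
  show ?thesis
  proof (rule that[OF U DU contV])
    fix \<phi> \<phi>' :: "real \<Rightarrow> real"
    assume \<phi>: "\<And>x. x \<in> {0..L} \<Longrightarrow> (\<phi> has_real_derivative \<phi>' x) (at x within {0..L})"
      and \<phi>': "continuous_on {0..L} \<phi>'"
    have cont\<phi>: "continuous_on {0..L} \<phi>"
      using \<phi> by (rule DERIV_continuous_on)
    have meas: "u \<in> borel_measurable ?M" "u' \<in> borel_measurable ?M" "U \<in> borel_measurable ?M"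
      "V \<in> borel_measurable ?M" "\<phi> \<in> borel_measurable ?M" "\<phi>' \<in> borel_measurable ?M"
      using u contU contV cont\<phi> \<phi>' by (auto simp: in_L2_def intro: continuous_on_borel_measurable_Ioo)
    have "integral {0..L} (\<lambda>x. V x * \<phi>' x) = (LINT x|?M. V x * \<phi>' x)"
      by (intro LINT_Ioo_eq_integral[symmetric] continuous_on_imp_integrable_Ioo continuous_intros contV \<phi>')
    also have "\<dots> = (LINT x|?M. u' x * \<phi>' x)"
    proof (rule integral_cong_AE)
      show "AE x in ?M. V x * \<phi>' x = u' x * \<phi>' x"
        using V by eventually_elim simp
    qed (use meas in simp_all)
    also have "\<dots> = (LINT x|?M. a x * u x * \<phi> x)"
      by (rule weak[OF H1_with_derivative_C1[OF L \<phi> \<phi>']])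
    also have "\<dots> = (LINT x|?M. a x * (U x * \<phi> x))"
    proof (rule integral_cong_AE)
      show "AE x in ?M. a x * u x * \<phi> x = a x * (U x * \<phi> x)"
        using U by eventually_elim simp
    qed (use meas a_meas in simp_all)
    also have "\<dots> = integral {0..L} (\<lambda>x. a x * (U x * \<phi> x))"
      by (intro LINT_Ioo_eq_integral integrable_mult_continuous_Ioo int_a continuous_intros contU cont\<phi>)
    finally show "integral {0..L} (\<lambda>x. V x * \<phi>' x) = integral {0..L} (\<lambda>x. a x * (U x * \<phi> x))" .
  qed
qed

section \<open>The quadratic form\<close>

lemma sin_nonzero_of_abs_le_half_pi:
  assumes "t \<noteq> 0" "\<bar>t\<bar> \<le> pi / 2"
  shows "sin t \<noteq> 0"
proof (cases "t > 0")
  case True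
  then show ?thesis
    using sin_gt_zero[of t] assms pi_gt_zero by (auto simp: abs_if)
next
  case False
  then show ?thesis
    using sin_gt_zero[of "- t"] assms pi_gt_zero by (auto simp: abs_if)
qed

text \<open>\<open>w\<close> is the frequency of the quarter sine wave that starts at
  \<open>z\<close> and is flat at the other end. This wave has no further zero in
  \<open>[p, q]\<close>, so \<open>u\<close> may be divided by it, and equality forces the quotient
  to be constant.\<close>

lemma wirtinger_mixed:
  fixes u v :: "real \<Rightarrow> real"
  assumes "p < q" and z: "z = p \<or> z = q" and w: "w = pi / (2 * (q - p))"
    and D: "\<And>x. x \<in> {p..q} \<Longrightarrow> (u has_real_derivative v x) (at x within {p..q})"
    and v: "continuous_on {p..q} v" and "u z = 0"
  shows "0 \<le> integral {p..q} (\<lambda>x. (v x)\<^sup>2 - w\<^sup>2 * (u x)\<^sup>2)" (is "0 \<le> integral _ ?F")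
    and "integral {p..q} (\<lambda>x. (v x)\<^sup>2 - w\<^sup>2 * (u x)\<^sup>2) = 0 \<Longrightarrow>
      \<exists>c. \<forall>x\<in>{p..q}. u x = c * sin (w * (x - z)) \<and> v x = c * w * cos (w * (x - z))"
proof -
  define s c where "s x = sin (w * (x - z))" and "c x = cos (w * (x - z))" for x
  have "w > 0" using \<open>p < q\<close> w by simp
  have s_nz: "s x \<noteq> 0" if "x \<in> {p..q}" "x \<noteq> z" for x
    unfolding s_def
  proof (rule sin_nonzero_of_abs_le_half_pi)
    have "\<bar>x - z\<bar> \<le> q - p"
      using that z by auto
    then have "w * \<bar>x - z\<bar> \<le> w * (q - p)"
      using \<open>w > 0\<close> by simp
    moreover have "w * (q - p) = pi / 2"
      using \<open>p < q\<close> by (simp add: w field_simps)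
    ultimately show "\<bar>w * (x - z)\<bar> \<le> pi / 2"
      using \<open>w > 0\<close> by (simp add: abs_mult)
  qed (use that \<open>w > 0\<close> in auto)
  have sc: "(s x)\<^sup>2 + (c x)\<^sup>2 = 1" for x
    by (simp add: s_def c_def)
  have Ds: "(s has_real_derivative w * c x) (at x within S)" for x S
    unfolding s_def[abs_def] c_def by (auto intro!: derivative_eq_intros)
  have Dc: "(c has_real_derivative - (w * s x)) (at x within S)" for x S
    unfolding c_def[abs_def] s_def by (auto intro!: derivative_eq_intros)
  have contu: "continuous_on {p..q} u"
    using D by (rule DERIV_continuous_on)
  have conts: "continuous_on S s" and contc: "continuous_on S c" for S
    using Ds Dc by (auto intro!: DERIV_continuous_on)
  \<comment> \<open>Picone's identity: \<open>v\<^sup>2 - w\<^sup>2 u\<^sup>2\<close> is a square plus the derivative of \<open>G\<close>. Division by zero gives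
    \<open>G z = 0\<close>, which is also the limit of \<open>G\<close> at \<open>z\<close>.\<close>
  define G where "G x = w * c x * (u x)\<^sup>2 / s x" for x
  define G' where "G' x = 2 * w * c x * u x * v x / s x - w\<^sup>2 * (u x)\<^sup>2 / (s x)\<^sup>2" for x
  \<comment> \<open>One end is \<open>z\<close>; at the other the argument of the cosine is
    \<open>pi / 2\<close> in absolute value.\<close>
  have G_ends: "G p = 0" "G q = 0"
  proof -
    have "G z = 0" using \<open>u z = 0\<close> by (simp add: G_def)
    moreover have "w * (q - p) = pi / 2" "w * (p - q) = - (pi / 2)"
      using \<open>p < q\<close> by (simp_all add: w field_simps)
    then have "cos (w * (q - p)) = 0" "cos (w * (p - q)) = 0"
      by (simp_all only: cos_minus cos_pi_half)
    then have "c p = 0 \<or> p = z" "c q = 0 \<or> q = z"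
      using z by (auto simp: c_def)
    ultimately show "G p = 0" "G q = 0"
      by (auto simp: G_def)
  qed
  have contG: "continuous_on {p..q} G"
  proof -
    have "(G \<longlongrightarrow> G x) (at x within {p..q})" if x: "x \<in> {p..q}" for x
    proof (cases "x = z")
      case True
      have "((\<lambda>y. (u y - u z) / (y - z)) \<longlongrightarrow> v z) (at z within {p..q})"
        using D[of z] x True by (simp add: has_field_derivative_iff)
      moreover have "((\<lambda>y. (s y - s z) / (y - z)) \<longlongrightarrow> w * c z) (at z within {p..q})"
        using Ds[of z] by (simp add: has_field_derivative_iff)
      moreover have "(u \<longlongrightarrow> u z) (at z within {p..q})" "(c \<longlongrightarrow> c z) (at z within {p..q})"
        using contu contc x True by (auto simp: continuous_on)
      moreover have "c z = 1" "s z = 0" by (simp_all add: c_def s_def)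
      \<comment> \<open>A ratio of difference quotients at \<open>z\<close> replaces
        \<open>u y / s y\<close> and has a finite limit; the remaining factor \<open>u y\<close>
        tends to 0.\<close>
      ultimately have "((\<lambda>y. w * c y * ((u y - u z) / (y - z)) * u y / ((s y - s z) / (y - z)))
          \<longlongrightarrow> w * c z * v z * u z / (w * c z)) (at z within {p..q})"
        using \<open>w > 0\<close> by (intro tendsto_intros) auto
      moreover have "\<forall>\<^sub>F y in at z within {p..q}.
          w * c y * ((u y - u z) / (y - z)) * u y / ((s y - s z) / (y - z)) = G y"
        using \<open>u z = 0\<close> \<open>s z = 0\<close>
        by (auto simp: eventually_at_filter G_def power2_eq_square)
      ultimately show ?thesis
        using Lim_transform_eventually True \<open>u z = 0\<close> by (fastforce simp: G_def)
    next
      case False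
      then show ?thesis
        unfolding G_def using x contu contc conts s_nz[OF x]
        by (intro tendsto_intros) (auto simp: continuous_on)
    qed
    then show ?thesis by (simp add: continuous_on)
  qed
  have DG: "(G has_vector_derivative G' x) (at x)" if "x \<in> {p<..<q}" for x
  proof -
    have "x \<noteq> z" using that z by auto
    then have nz: "s x \<noteq> 0" using that s_nz by auto
    have Du: "(u has_real_derivative v x) (at x)"
      using D[of x] that by (simp add: at_within_Icc_at)
    have "((w * - (w * s x)) * (u x)\<^sup>2 + w * c x * (2 * u x * v x)) * s x - w * c x * (u x)\<^sup>2 * (w * c x)
        = 2 * w * c x * u x * v x * s x - w\<^sup>2 * (u x)\<^sup>2 * ((s x)\<^sup>2 + (c x)\<^sup>2)" (is "?N = _")
      by (simp add: power2_eq_square algebra_simps)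
    then have "?N / (s x * s x) = G' x"
      unfolding sc G'_def using nz by (simp add: diff_divide_distrib power2_eq_square)
    moreover have "(G has_real_derivative ?N / (s x * s x)) (at x)"
      unfolding G_def[abs_def] using nz by (auto intro!: derivative_eq_intros Du Ds Dc)
    ultimately have "(G has_real_derivative G' x) (at x)"
      by simp
    then show ?thesis
      by (simp add: has_real_derivative_iff_has_vector_derivative)
  qed
  define R where "R x = ?F x - G' x" for x
  have "(G' has_integral 0) {p..q}"
    using fundamental_theorem_of_calculus_interior[OF _ contG DG] \<open>p < q\<close> G_ends by simp
  moreover have "(?F has_integral integral {p..q} ?F) {p..q}"
    by (intro integrable_integral integrable_continuous_real continuous_intros v contu)
  ultimately have R: "(R has_integral integral {p..q} ?F) {p..q}"
    unfolding R_def[abs_def] using has_integral_diff[of ?F _ "{p..q}" G' 0] by simp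
  have R_eq: "R x = (v x - w * c x * u x / s x)\<^sup>2" if "x \<in> {p..q}" "x \<noteq> z" for x
  proof -
    define t where "t = u x / s x"
    have u: "u x = t * s x"
      using s_nz[OF that] by (simp add: t_def)
    have "R x = (v x)\<^sup>2 - 2 * w * c x * t * v x + w\<^sup>2 * t\<^sup>2 * (1 - (s x)\<^sup>2)"
      using s_nz[OF that] unfolding R_def G'_def u by (simp add: power_mult_distrib algebra_simps)
    also have "1 - (s x)\<^sup>2 = (c x)\<^sup>2"
      using sc[of x] by linarith
    also have "(v x)\<^sup>2 - 2 * w * c x * t * v x + w\<^sup>2 * t\<^sup>2 * (c x)\<^sup>2 = (v x - w * c x * t)\<^sup>2"
      by (simp add: power2_diff power_mult_distrib algebra_simps)
    finally show ?thesis
      by (simp add: t_def)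
  qed
  \<comment> \<open>At \<open>z\<close> the terms of \<open>G'\<close> vanish because
    \<open>u z = 0\<close>, which leaves the square of \<open>v z\<close>.\<close>
  have R_nonneg: "0 \<le> R x" if "x \<in> {p..q}" for x
    using R_eq[OF that] \<open>u z = 0\<close> by (cases "x = z") (simp_all add: R_def G'_def)
  show "0 \<le> integral {p..q} ?F"
    using has_integral_nonneg[OF R R_nonneg] .
  assume "integral {p..q} ?F = 0"
  with R have R0: "R integrable_on {p..q}" "integral {p..q} R = 0"
    by (simp_all add: has_integral_iff)
  have "continuous_on {p<..<q} R"
  proof (rule continuous_on_eq)
    show "continuous_on {p<..<q} (\<lambda>x. (v x - w * c x * u x / s x)\<^sup>2)"
      using s_nz z by (intro continuous_intros conts contc continuous_on_subset[OF v] continuous_on_subset[OF contu]) auto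
  qed (use R_eq z in auto)
  then have R_zero: "R x = 0" if x: "x \<in> {p<..<q}" for x
  proof -
    \<comment> \<open>Continuity of \<open>R\<close> has been shown only in the interior, as
      \<open>s\<close> vanishes at one end, so the zero integral is exploited on a compact
      subinterval around \<open>x\<close>.\<close>
    define p' q' where "p' = (p + x) / 2" and "q' = (x + q) / 2"
    have pq: "p < p'" "p' < x" "x < q'" "q' < q"
      using x by (auto simp: p'_def q'_def)
    then have "continuous_on {p'..q'} R"
      using \<open>continuous_on {p<..<q} R\<close> by (auto elim: continuous_on_subset)
    moreover have "integral {p'..q'} R = 0"
    proof (rule antisym)
      show "integral {p'..q'} R \<le> 0"
        using integral_subset_le[of "{p'..q'}" "{p..q}" R] pq R0 R_nonneg
          integrable_on_subinterval[OF R0(1), of p' q'] by auto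
      show "0 \<le> integral {p'..q'} R"
        using pq R_nonneg integrable_on_subinterval[OF R0(1), of p' q'] by (intro integral_nonneg) auto
    qed
    ultimately show ?thesis
      using integral_eq_0_iff[of p' q' R] pq R_nonneg by auto
  qed
  have v_eq: "v x = w * c x * u x / s x" if "x \<in> {p<..<q}" for x
    using R_zero[OF that] R_eq[of x] that z by auto
  have "((\<lambda>x. u x / s x) has_real_derivative 0) (at x)" if "x \<in> {p<..<q}" for x
  proof -
    have nz: "s x \<noteq> 0" using that s_nz z by auto
    have Du: "(u has_real_derivative v x) (at x)"
      using D[of x] that by (simp add: at_within_Icc_at)
    show ?thesis
      by (rule DERIV_cong[OF DERIV_divide[OF Du Ds nz]]) (use nz v_eq[OF that] in simp)
  qed
  then have const: "u x / s x = u ((p + q) / 2) / s ((p + q) / 2)" if "x \<in> {p<..<q}" for x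
    using that \<open>p < q\<close> by (intro DERIV_isconst3[of p q x "(p + q) / 2"]) auto
  define k where "k = u ((p + q) / 2) / s ((p + q) / 2)"
  have u_int: "u x - k * s x = 0" if "x \<in> {p<..<q}" for x
    using const[OF that] s_nz[of x] that z by (auto simp: k_def[symmetric] field_simps)
  have v_int: "v x - k * w * c x = 0" if "x \<in> {p<..<q}" for x
    using v_eq[OF that] u_int[OF that] s_nz[of x] that z by auto
  \<comment> \<open>Both identities pass from the open interval to its ends by continuity.\<close>
  have cl: "closure {p<..<q} = {p..q}" using \<open>p < q\<close> by simp
  show "\<exists>c. \<forall>x\<in>{p..q}. u x = c * sin (w * (x - z)) \<and> v x = c * w * cos (w * (x - z))"
  proof (intro exI[of _ k] ballI conjI)
    fix x assume x: "x \<in> {p..q}"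
    have "u x - k * s x = 0"
      by (rule continuous_constant_on_closure[of "{p<..<q}"])
        (use x u_int in \<open>auto simp: cl intro!: continuous_intros contu conts\<close>)
    then show "u x = k * sin (w * (x - z))" by (simp add: s_def)
    have "v x - k * w * c x = 0"
      by (rule continuous_constant_on_closure[of "{p<..<q}"])
        (use x v_int in \<open>auto simp: cl intro!: continuous_intros v contc\<close>)
    then show "v x = k * w * cos (w * (x - z))" by (simp add: c_def)
  qed
qed

section \<open>Homogeneous systems with more unknowns than equations\<close>

text \<open>Gaussian elimination by induction on the equations: equation \<open>i0\<close> is solved
  for an unknown \<open>j0\<close> with nonzero coefficient, and \<open>A'\<close> is the reduced
  system for the other unknowns.\<close>

lemma underdetermined_system_nontrivial_solution:
  fixes A :: "'i \<Rightarrow> 'j \<Rightarrow> 'f::field"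
  assumes "finite I" "finite J" "card I < card J"
  shows "\<exists>b. (\<exists>j\<in>J. b j \<noteq> 0) \<and> (\<forall>i\<in>I. (\<Sum>j\<in>J. A i j * b j) = 0)"
  using assms
proof (induction I arbitrary: J A rule: finite_induct)
  case empty
  then obtain j where "j \<in> J" by (metis all_not_in_conv card.empty less_irrefl)
  then show ?case by (intro exI[of _ "\<lambda>_. 1"]) auto
next
  case (insert i0 I)
  show ?case
  proof (cases "\<forall>j\<in>J. A i0 j = 0")
    case True
    have "card I < card J"
      using insert.prems(2) insert.hyps by simp
    from insert.IH[OF insert.prems(1) this, of A] obtain b where
      "\<exists>j\<in>J. b j \<noteq> 0" "\<forall>i\<in>I. (\<Sum>j\<in>J. A i j * b j) = 0" by blast
    with True show ?thesis by (intro exI[of _ b]) auto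
  next
    case False
    then obtain j0 where j0: "j0 \<in> J" "A i0 j0 \<noteq> 0" by blast
    define A' where "A' i j = A i j - A i j0 * A i0 j / A i0 j0" for i j
    have "card I < card (J - {j0})"
      using insert j0 by simp
    from insert.IH[OF _ this, of A'] insert.prems obtain b where
      b: "\<exists>j\<in>J - {j0}. b j \<noteq> 0" "\<And>i. i \<in> I \<Longrightarrow> (\<Sum>j\<in>J - {j0}. A' i j * b j) = 0"
      by auto
    define t where "t = (\<Sum>j\<in>J - {j0}. A i0 j * b j) / A i0 j0"
    define b' where "b' = b(j0 := - t)"
    have split: "(\<Sum>j\<in>J. A i j * b' j) = (\<Sum>j\<in>J - {j0}. A i j * b j) - A i j0 * t" for i
      using j0 insert.prems by (subst sum.remove[of J j0]) (auto simp: b'_def)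
    have "(\<Sum>j\<in>J. A i j * b' j) = 0" if "i \<in> insert i0 I" for i
    proof (cases "i = i0")
      case True
      then show ?thesis using j0 by (simp add: split t_def)
    next
      case False
      have "(\<Sum>j\<in>J - {j0}. A' i j * b j) = (\<Sum>j\<in>J - {j0}. A i j * b j) - A i j0 * t"
        by (simp add: A'_def t_def left_diff_distrib sum_subtractf sum_distrib_left sum_divide_distrib mult.assoc)
      with False that b(2) show ?thesis by (simp add: split)
    qed
    moreover have "\<exists>j\<in>J. b' j \<noteq> 0"
      using b(1) by (auto simp: b'_def)
    ultimately show ?thesis by blast
  qed
qed

section \<open>Partitions and nonnegativity of the form\<close>

lemma mono_upto:
  fixes y :: "nat \<Rightarrow> 'a::preorder"
  assumes "\<And>i. i < m \<Longrightarrow> y i \<le> y (Suc i)" "i \<le> j" "j \<le> m"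
  shows "y i \<le> y j"
  using assms(2,3)
proof (induction j rule: dec_induct)
  case (step k)
  then have "y i \<le> y k" "y k \<le> y (Suc k)"
    using assms(1) by auto
  then show ?case by (rule order_trans)
qed simp

lemma integral_partition:
  fixes f :: "real \<Rightarrow> real"
  assumes "\<And>i. i < m \<Longrightarrow> y i \<le> y (Suc i)" "f integrable_on {y 0..y m}"
  shows "integral {y 0..y m} f = (\<Sum>i<m. integral {y i..y (Suc i)} f)"
  using assms
proof (induction m)
  case (Suc m)
  have "y 0 \<le> y m"
    by (rule mono_upto[of m]) (use Suc.prems(1) in auto)
  moreover have "y m \<le> y (Suc m)" using Suc.prems by simp
  moreover have "f integrable_on {y 0..y m}"
    by (rule integrable_on_subinterval[OF Suc.prems(2)]) (use \<open>y m \<le> y (Suc m)\<close> in auto)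
  ultimately have "integral {y 0..y m} f = (\<Sum>i<m. integral {y i..y (Suc i)} f)"
    and "integral {y 0..y (Suc m)} f = integral {y 0..y m} f + integral {y m..y (Suc m)} f"
    using Suc.IH Suc.prems
      Henstock_Kurzweil_Integration.integral_combine[of "y 0" "y m" "y (Suc m)" f] by simp_all
  then show ?case by simp
qed simp

lemma in_partition_interval:
  fixes y :: "nat \<Rightarrow> 'a::linorder"
  assumes "x \<in> {y 0..y m}" "m > 0"
  shows "\<exists>i<m. x \<in> {y i..y (Suc i)}"
  using assms
proof (induction m)
  case (Suc m)
  show ?case
  proof (cases "m > 0 \<and> x \<le> y m")
    case True
    with Suc show ?thesis by (auto intro: less_SucI)
  next
    case False
    with Suc.prems show ?thesis by (intro exI[of _ m]) auto
  qed
qed simp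

lemma AE_lebesgue_on_Ioo_iff_Icc:
  fixes l r :: real
  shows "(AE x in lebesgue_on {l<..<r}. P x) \<longleftrightarrow> (AE x in lebesgue_on {l..r}. P x)"
proof -
  have "{l, r} \<in> null_sets lebesgue"
    by (simp add: negligible_iff_null_sets[symmetric])
  then have "AE x in lebesgue. x \<notin> {l, r}"
    by (rule AE_not_in)
  then have "AE x in lebesgue. (x \<in> {l<..<r} \<longrightarrow> P x) = (x \<in> {l..r} \<longrightarrow> P x)"
    by eventually_elim auto
  then have "(AE x in lebesgue. x \<in> {l<..<r} \<longrightarrow> P x) \<longleftrightarrow> (AE x in lebesgue. x \<in> {l..r} \<longrightarrow> P x)"
    by (rule eventually_subst)
  then show ?thesis
    by (simp add: AE_restrict_space_iff)
qed

lemma integral_nonneg_AE_Ioo: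
  fixes f :: "real \<Rightarrow> real"
  assumes "integrable (lebesgue_on {p<..<q}) f" "AE x in lebesgue_on {p<..<q}. 0 \<le> f x"
  shows "0 \<le> integral {p..q} f"
    and "integral {p..q} f = 0 \<Longrightarrow> AE x in lebesgue_on {p<..<q}. f x = 0"
  using assms integral_nonneg_AE[OF assms(2)] integral_nonneg_eq_0_iff_AE[OF assms]
  by (auto simp: LINT_Ioo_eq_integral)

text \<open>On each piece the form splits into a Wirtinger part \<open>A i\<close> and the integral
  \<open>B i\<close> of \<open>((w i)\<^sup>2 - a) f\<^sup>2\<close>, both nonnegative. If the total
  is zero, all of these vanish separately.\<close>

lemma quadratic_form_nonneg:
  fixes y z :: "nat \<Rightarrow> real" and a f f' :: "real \<Rightarrow> real" and m :: nat
  defines "w \<equiv> \<lambda>i. pi / (2 * (y (Suc i) - y i))"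
  assumes y: "\<And>i. i < m \<Longrightarrow> y i < y (Suc i)"
    and z: "\<And>i. i < m \<Longrightarrow> z i = y i \<or> z i = y (Suc i)" "\<And>i. i < m \<Longrightarrow> f (z i) = 0"
    and D: "\<And>x. x \<in> {y 0..y m} \<Longrightarrow> (f has_real_derivative f' x) (at x within {y 0..y m})"
    and f': "continuous_on {y 0..y m} f'"
    and af: "integrable (lebesgue_on {y 0..y m}) (\<lambda>x. a x * (f x)\<^sup>2)"
    and a: "\<And>i. i < m \<Longrightarrow> AE x in lebesgue_on {y i<..<y (Suc i)}. a x \<le> (w i)\<^sup>2"
  shows "0 \<le> integral {y 0..y m} (\<lambda>x. (f' x)\<^sup>2 - a x * (f x)\<^sup>2)"
    and "integral {y 0..y m} (\<lambda>x. (f' x)\<^sup>2 - a x * (f x)\<^sup>2) = 0 \<Longrightarrow> i < m \<Longrightarrow>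
      (\<exists>c. \<forall>x\<in>{y i..y (Suc i)}. f x = c * sin (w i * (x - z i)) \<and> f' x = c * w i * cos (w i * (x - z i))) \<and>
      (AE x in lebesgue_on {y i<..<y (Suc i)}. ((w i)\<^sup>2 - a x) * (f x)\<^sup>2 = 0)"
proof -
  define P where "P i = integral {y i..y (Suc i)} (\<lambda>x. (f' x)\<^sup>2 - a x * (f x)\<^sup>2)" for i
  define A where "A i = integral {y i..y (Suc i)} (\<lambda>x. (f' x)\<^sup>2 - (w i)\<^sup>2 * (f x)\<^sup>2)" for i
  define B where "B i = integral {y i..y (Suc i)} (\<lambda>x. ((w i)\<^sup>2 - a x) * (f x)\<^sup>2)" for i
  have sub: "{y i..y (Suc i)} \<subseteq> {y 0..y m}" if "i < m" for i
    using mono_upto[of m y 0 i] mono_upto[of m y "Suc i" m] y that by (auto simp: less_imp_le)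
  have f: "continuous_on {y 0..y m} f"
    using D by (rule DERIV_continuous_on)
  have Di: "(f has_real_derivative f' x) (at x within {y i..y (Suc i)})"
    if "i < m" "x \<in> {y i..y (Suc i)}" for i x
    using D sub[OF that(1)] that(2) by (meson DERIV_subset subsetD)
  have ci: "continuous_on {y i..y (Suc i)} f" "continuous_on {y i..y (Suc i)} f'" if "i < m" for i
    using f f' sub[OF that] by (auto intro: continuous_on_subset)
  have afi: "integrable (lebesgue_on {y i<..<y (Suc i)}) (\<lambda>x. a x * (f x)\<^sup>2)" if "i < m" for i
    using integrable_subinterval[OF af sub[OF that]] by (simp add: integrable_lebesgue_on_Ioo_iff)
  have Bint: "integrable (lebesgue_on {y i<..<y (Suc i)}) (\<lambda>x. ((w i)\<^sup>2 - a x) * (f x)\<^sup>2)" if "i < m" for i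
    unfolding left_diff_distrib using that ci
    by (intro Bochner_Integration.integrable_diff afi continuous_on_imp_integrable_Ioo continuous_intros)
  have Bnn: "AE x in lebesgue_on {y i<..<y (Suc i)}. 0 \<le> ((w i)\<^sup>2 - a x) * (f x)\<^sup>2" if "i < m" for i
    using a[OF that] by eventually_elim simp
  have PAB: "P i = A i + B i" if "i < m" for i
  proof -
    have "(\<lambda>x. (f' x)\<^sup>2 - (w i)\<^sup>2 * (f x)\<^sup>2) integrable_on {y i..y (Suc i)}"
      using that ci by (intro integrable_continuous_real continuous_intros)
    moreover have "(\<lambda>x. ((w i)\<^sup>2 - a x) * (f x)\<^sup>2) integrable_on {y i..y (Suc i)}"
      using Bint[OF that] by (simp add: integrable_lebesgue_on_Ioo_iff integrable_on_lebesgue_on)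
    ultimately show ?thesis
      unfolding P_def A_def B_def
      by (simp add: Henstock_Kurzweil_Integration.integral_add[symmetric] algebra_simps)
  qed
  have A: "0 \<le> A i" and A0: "A i = 0 \<Longrightarrow> \<exists>c. \<forall>x\<in>{y i..y (Suc i)}.
      f x = c * sin (w i * (x - z i)) \<and> f' x = c * w i * cos (w i * (x - z i))" if "i < m" for i
    unfolding A_def using wirtinger_mixed[of "y i" "y (Suc i)" "z i" "w i" f f'] that y z Di ci
    by (auto simp: w_def)
  have B: "0 \<le> B i" and B0: "B i = 0 \<Longrightarrow> AE x in lebesgue_on {y i<..<y (Suc i)}. ((w i)\<^sup>2 - a x) * (f x)\<^sup>2 = 0"
    if "i < m" for i
    unfolding B_def using integral_nonneg_AE_Ioo[OF Bint Bnn] that by auto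
  have "(\<lambda>x. (f' x)\<^sup>2 - a x * (f x)\<^sup>2) integrable_on {y 0..y m}"
    using af f' by (intro integrable_diff integrable_continuous_real continuous_intros integrable_on_lebesgue_on) auto
  then have total: "integral {y 0..y m} (\<lambda>x. (f' x)\<^sup>2 - a x * (f x)\<^sup>2) = (\<Sum>i<m. P i)"
    unfolding P_def using y by (intro integral_partition) (auto simp: less_imp_le)
  have P: "0 \<le> P i" if "i < m" for i
    using PAB A B that by simp
  then show "0 \<le> integral {y 0..y m} (\<lambda>x. (f' x)\<^sup>2 - a x * (f x)\<^sup>2)"
    unfolding total by (intro sum_nonneg) auto
  assume "integral {y 0..y m} (\<lambda>x. (f' x)\<^sup>2 - a x * (f x)\<^sup>2) = 0" "i < m"
  then have "P i = 0"
    unfolding total using P by (subst (asm) sum_nonneg_eq_0_iff) auto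
  then have "A i = 0" "B i = 0"
    using PAB[of i] A[of i] B[of i] \<open>i < m\<close> by auto
  then show "(\<exists>c. \<forall>x\<in>{y i..y (Suc i)}. f x = c * sin (w i * (x - z i)) \<and> f' x = c * w i * cos (w i * (x - z i))) \<and>
      (AE x in lebesgue_on {y i<..<y (Suc i)}. ((w i)\<^sup>2 - a x) * (f x)\<^sup>2 = 0)"
    using A0 B0 \<open>i < m\<close> by simp
qed

section \<open>The Neumann modes\<close>

definition neumann_mode :: "real \<Rightarrow> nat \<Rightarrow> real \<Rightarrow> real" where
  "neumann_mode L k x = cos (real k * pi / L * x)"

definition neumann_mode_deriv :: "real \<Rightarrow> nat \<Rightarrow> real \<Rightarrow> real" where
  "neumann_mode_deriv L k x = - (real k * pi / L) * sin (real k * pi / L * x)"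

lemma neumann_mode_DERIV:
  "(neumann_mode L k has_real_derivative neumann_mode_deriv L k x) (at x within S)"
proof -
  have "((\<lambda>x. cos (m * x)) has_real_derivative - m * sin (m * x)) (at x within S)" for m :: real
    by (auto intro!: derivative_eq_intros)
  then show ?thesis
    unfolding neumann_mode_def[abs_def] neumann_mode_deriv_def .
qed

lemma neumann_mode_deriv_DERIV:
  "(neumann_mode_deriv L k has_real_derivative - neumann_eigenvalue L k * neumann_mode L k x) (at x within S)"
proof -
  have "((\<lambda>x. - m * sin (m * x)) has_real_derivative - m\<^sup>2 * cos (m * x)) (at x within S)" for m :: real
    by (auto intro!: derivative_eq_intros simp: power2_eq_square)
  then show ?thesis
    unfolding neumann_mode_def neumann_mode_deriv_def[abs_def] neumann_eigenvalue_def
      power_mult_distrib[symmetric] power_divide[symmetric] .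
qed

lemma continuous_on_neumann_mode: "continuous_on S (neumann_mode L k)"
  and continuous_on_neumann_mode_deriv: "continuous_on S (neumann_mode_deriv L k)"
  using neumann_mode_DERIV neumann_mode_deriv_DERIV by (auto intro!: DERIV_continuous_on)

lemma neumann_eigenvalue_less_iff:
  assumes "L > 0"
  shows "neumann_eigenvalue L j < neumann_eigenvalue L k \<longleftrightarrow> j < k"
proof -
  have "(real j)\<^sup>2 < (real k)\<^sup>2 \<longleftrightarrow> j < k"
    by (simp add: not_le[symmetric] abs_le_square_iff[symmetric])
  then show ?thesis
    using assms by (simp add: neumann_eigenvalue_def divide_less_cancel)
qed

text \<open>Integration by parts; the boundary terms vanish because the sine in the derivative of a
  mode is zero at 0 and at \<open>L\<close>.\<close>

lemma neumann_mode_energy: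
  assumes "L > 0"
  shows "integral {0..L} (\<lambda>x. neumann_mode_deriv L j x * neumann_mode_deriv L k x) =
    neumann_eigenvalue L j * integral {0..L} (\<lambda>x. neumann_mode L j x * neumann_mode L k x)"
proof -
  have "((\<lambda>x. neumann_mode_deriv L j x * neumann_mode_deriv L k x
        - neumann_eigenvalue L j * (neumann_mode L j x * neumann_mode L k x)) has_integral
      (neumann_mode_deriv L j L * neumann_mode L k L - neumann_mode_deriv L j 0 * neumann_mode L k 0)) {0..L}"
    using assms
    by (intro fundamental_theorem_of_calculus)
      (auto simp: has_real_derivative_iff_has_vector_derivative[symmetric] algebra_simps
        intro!: derivative_eq_intros neumann_mode_DERIV neumann_mode_deriv_DERIV)
  moreover have "neumann_mode_deriv L j L = 0" "neumann_mode_deriv L j 0 = 0"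
    using assms by (simp_all add: neumann_mode_deriv_def sin_npi)
  ultimately have "integral {0..L} (\<lambda>x. neumann_mode_deriv L j x * neumann_mode_deriv L k x
        - neumann_eigenvalue L j * (neumann_mode L j x * neumann_mode L k x)) = 0"
    by (simp add: integral_unique)
  then show ?thesis
    by (subst (asm) Henstock_Kurzweil_Integration.integral_diff)
      (auto intro!: integrable_continuous_real continuous_intros continuous_on_neumann_mode continuous_on_neumann_mode_deriv)
qed

text \<open>The energy is symmetric in \<open>j\<close> and \<open>k\<close>, while the two
  eigenvalues it produces as factors differ.\<close>

lemma neumann_mode_orthogonal:
  assumes "L > 0" "j \<noteq> k"
  shows "integral {0..L} (\<lambda>x. neumann_mode L j x * neumann_mode L k x) = 0"
proof -
  let ?I = "integral {0..L} (\<lambda>x. neumann_mode L j x * neumann_mode L k x)"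
  have "neumann_eigenvalue L j * ?I = neumann_eigenvalue L k * ?I"
    using neumann_mode_energy[OF assms(1), of j k] neumann_mode_energy[OF assms(1), of k j]
    by (simp add: mult.commute)
  moreover have "neumann_eigenvalue L j \<noteq> neumann_eigenvalue L k"
    using assms neumann_eigenvalue_less_iff[OF assms(1)] by (metis linorder_neq_iff)
  ultimately show ?thesis by simp
qed

lemma neumann_mode_norm_pos:
  assumes "L > 0"
  shows "0 < integral {0..L} (\<lambda>x. (neumann_mode L k x)\<^sup>2)"
proof -
  have cont: "continuous_on {0..L} (\<lambda>x. (neumann_mode L k x)\<^sup>2)"
    by (intro continuous_intros continuous_on_neumann_mode)
  have "neumann_mode L k 0 = 1"
    by (simp add: neumann_mode_def)
  then have "integral {0..L} (\<lambda>x. (neumann_mode L k x)\<^sup>2) \<noteq> 0"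
    using assms by (subst integral_eq_0_iff[OF cont]) (auto intro!: bexI[of _ 0])
  moreover have "0 \<le> integral {0..L} (\<lambda>x. (neumann_mode L k x)\<^sup>2)"
    by (intro integral_nonneg integrable_continuous_real cont) auto
  ultimately show ?thesis by simp
qed

text \<open>The modes are orthogonal for the energy and for the L^2 product alike, so only the
  diagonal of the double sum survives.\<close>

lemma neumann_modes_quadratic_form:
  fixes b :: "nat \<Rightarrow> real"
  assumes "L > 0" "finite J"
  shows "integral {0..L} (\<lambda>x. (\<Sum>j\<in>J. b j * neumann_mode_deriv L j x)\<^sup>2 - \<mu> * (\<Sum>j\<in>J. b j * neumann_mode L j x)\<^sup>2)
    = (\<Sum>j\<in>J. (b j)\<^sup>2 * (neumann_eigenvalue L j - \<mu>) * integral {0..L} (\<lambda>x. (neumann_mode L j x)\<^sup>2))"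
proof -
  let ?c = "neumann_mode L" and ?c' = "neumann_mode_deriv L"
  let ?I = "\<lambda>j k. integral {0..L} (\<lambda>x. ?c j x * ?c k x)"
  have hI: "((\<lambda>x. b j * b k * (?c' j x * ?c' k x - \<mu> * (?c j x * ?c k x))) has_integral
      b j * b k * (neumann_eigenvalue L j - \<mu>) * ?I j k) {0..L}" for j k
  proof -
    have "((\<lambda>x. ?c' j x * ?c' k x - \<mu> * (?c j x * ?c k x)) has_integral
        neumann_eigenvalue L j * ?I j k - \<mu> * ?I j k) {0..L}"
      unfolding neumann_mode_energy[OF assms(1), symmetric]
      by (intro has_integral_diff has_integral_mult_right integrable_integral integrable_continuous_real
          continuous_intros continuous_on_neumann_mode continuous_on_neumann_mode_deriv)
    from has_integral_mult_right[OF this, of "b j * b k"] show ?thesis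
      by (simp add: algebra_simps)
  qed
  have "((\<lambda>x. \<Sum>j\<in>J. \<Sum>k\<in>J. b j * b k * (?c' j x * ?c' k x - \<mu> * (?c j x * ?c k x))) has_integral
      (\<Sum>j\<in>J. \<Sum>k\<in>J. b j * b k * (neumann_eigenvalue L j - \<mu>) * ?I j k)) {0..L}"
    by (intro has_integral_sum assms hI)
  moreover have "(\<Sum>j\<in>J. \<Sum>k\<in>J. b j * b k * (?c' j x * ?c' k x - \<mu> * (?c j x * ?c k x))) =
      (\<Sum>j\<in>J. b j * ?c' j x)\<^sup>2 - \<mu> * (\<Sum>j\<in>J. b j * ?c j x)\<^sup>2" for x
    by (simp add: power2_eq_square sum_product sum_distrib_left sum_subtractf algebra_simps)
  moreover have "(\<Sum>k\<in>J. b j * b k * (neumann_eigenvalue L j - \<mu>) * ?I j k) =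
      (b j)\<^sup>2 * (neumann_eigenvalue L j - \<mu>) * integral {0..L} (\<lambda>x. (?c j x)\<^sup>2)" if "j \<in> J" for j
  proof -
    have "(\<Sum>k\<in>J. b j * b k * (neumann_eigenvalue L j - \<mu>) * ?I j k) =
        (\<Sum>k\<in>J. if k = j then (b j)\<^sup>2 * (neumann_eigenvalue L j - \<mu>) * integral {0..L} (\<lambda>x. (?c j x)\<^sup>2) else 0)"
      by (intro sum.cong) (auto simp: neumann_mode_orthogonal[OF assms(1)] power2_eq_square)
    then show ?thesis
      using that assms(2) by simp
  qed
  ultimately show ?thesis
    by (simp add: integral_unique)
qed

text \<open>The zeros are among the integer multiples of one number, hence countable. This allows
  the mode to be cancelled from an identity that holds almost everywhere.\<close>

lemma AE_neumann_mode_nonzero: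
  assumes "L > 0" "k > 0" and S: "S \<in> sets lebesgue"
  shows "AE x in lebesgue_on S. neumann_mode L k x \<noteq> 0"
proof -
  have "{x. neumann_mode L k x = 0} \<subseteq> range (\<lambda>i::int. of_int i * (pi / 2) * (L / (real k * pi)))"
  proof
    fix x assume "x \<in> {x. neumann_mode L k x = 0}"
    then obtain i :: int where "real k * pi / L * x = of_int i * (pi / 2)"
      by (auto simp: neumann_mode_def cos_zero_iff_int)
    then have "x = of_int i * (pi / 2) * (L / (real k * pi))"
      using assms by (simp add: field_simps)
    then show "x \<in> range (\<lambda>i::int. of_int i * (pi / 2) * (L / (real k * pi)))"
      by blast
  qed
  then have "countable {x. neumann_mode L k x = 0}"
    by (rule countable_subset) simp
  then have "{x. neumann_mode L k x = 0} \<in> null_sets lebesgue"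
    by (intro null_sets_completionI countable_imp_null_set_lborel)
  then have "AE x in lebesgue. neumann_mode L k x \<noteq> 0"
    using AE_not_in[of "{x. neumann_mode L k x = 0}" lebesgue] by simp
  then show ?thesis
    using S by (auto simp: AE_restrict_space_iff elim: eventually_mono)
qed

section \<open>Triviality of continuously differentiable solutions\<close>

text \<open>Strictness enters as two negated almost-everywhere equalities:
  \<open>lower_strict\<close> excludes the top mode \<open>n\<close>, and
  \<open>upper_strict\<close> provides the piece on which \<open>U\<close> first vanishes.\<close>

theorem neumann_regular_solution_trivial:
  fixes L :: real and n :: nat and a U V :: "real \<Rightarrow> real" and y :: "nat \<Rightarrow> real"
  assumes L: "L > 0" and n: "n \<ge> 1"
    and a: "integrable (lebesgue_on {0<..<L}) a"
    and lower: "AE x in lebesgue_on {0<..<L}. neumann_eigenvalue L n \<le> a x"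
    and lower_strict: "\<not> (AE x in lebesgue_on {0<..<L}. a x = neumann_eigenvalue L n)"
    and y: "y 0 = 0" "y (2 * n + 2) = L" "\<And>i. i < 2 * n + 2 \<Longrightarrow> y i < y (Suc i)"
    and upper: "\<And>i. i < 2 * n + 2 \<Longrightarrow>
      AE x in lebesgue_on {y i<..<y (Suc i)}. a x \<le> (pi / (2 * (y (Suc i) - y i)))\<^sup>2"
    and upper_strict: "\<exists>i<2 * n + 2.
      \<not> (AE x in lebesgue_on {y i<..<y (Suc i)}. a x = (pi / (2 * (y (Suc i) - y i)))\<^sup>2)"
    and DU: "\<And>x. x \<in> {0..L} \<Longrightarrow> (U has_real_derivative V x) (at x within {0..L})"
    and V: "continuous_on {0..L} V"
    and weak: "\<And>\<phi> \<phi>'. (\<And>x. x \<in> {0..L} \<Longrightarrow> (\<phi> has_real_derivative \<phi>' x) (at x within {0..L})) \<Longrightarrow>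
           continuous_on {0..L} \<phi>' \<Longrightarrow>
           integral {0..L} (\<lambda>x. V x * \<phi>' x) = integral {0..L} (\<lambda>x. a x * (U x * \<phi> x))"
    and x: "x \<in> {0..L}"
  shows "U x = 0"
proof -
  let ?m = "2 * n + 2" and ?\<mu> = "neumann_eigenvalue L n"
  define w where "w i = pi / (2 * (y (Suc i) - y i))" for i
  \<comment> \<open>Each piece has exactly one end of odd index, the right one for even
    \<open>i\<close> and the left one for odd \<open>i\<close>. Thus \<open>n + 1\<close> nodes
    serve all \<open>2 * n + 2\<close> pieces.\<close>
  define z where "z i = (if even i then y (Suc i) else y i)" for i
  have U: "continuous_on {0..L} U"
    using DU by (rule DERIV_continuous_on)
  have int_a: "integrable (lebesgue_on {0..L}) (\<lambda>x. a x * g x)" if "continuous_on {0..L} g" for g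
    using integrable_mult_continuous_Ioo[OF a that] by (simp add: integrable_lebesgue_on_Ioo_iff)
  have int_a': "(\<lambda>x. a x * g x) integrable_on {0..L}" if "continuous_on {0..L} g" for g
    using int_a[OF that] by (simp add: integrable_on_lebesgue_on)
  have odd_nodes: "f (z i) = 0" if "\<And>k. k \<le> n \<Longrightarrow> f (y (2 * k + 1)) = 0" "i < ?m" for f :: "real \<Rightarrow> real" and i
  proof -
    have "z i = y (2 * (i div 2) + 1)"
      by (simp add: z_def)
    moreover have "i div 2 \<le> n"
      using that by auto
    ultimately show ?thesis
      using that(1) by simp
  qed
  note form = quadratic_form_nonneg[of ?m y z, folded w_def, unfolded y]
  \<comment> \<open>Indices up to \<open>n\<close> carry the modes and \<open>Suc n\<close> carries
    \<open>U\<close>: \<open>n + 2\<close> unknowns against \<open>n + 1\<close> equations.\<close>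
  define e where "e j = (if j \<le> n then neumann_mode L j else U)" for j
  obtain b where b: "\<exists>j\<in>{..Suc n}. b j \<noteq> 0"
    "\<And>k. k \<le> n \<Longrightarrow> (\<Sum>j\<le>Suc n. e j (y (2 * k + 1)) * b j) = 0"
    using underdetermined_system_nontrivial_solution[of "{..n}" "{..Suc n}" "\<lambda>k j. e j (y (2 * k + 1))"]
    by auto
  define \<beta> where "\<beta> = b (Suc n)"
  define \<psi> where "\<psi> x = (\<Sum>j\<le>n. b j * neumann_mode L j x)" for x
  define \<psi>' where "\<psi>' x = (\<Sum>j\<le>n. b j * neumann_mode_deriv L j x)" for x
  define \<phi> where "\<phi> x = \<psi> x + \<beta> * U x" for x
  define \<phi>' where "\<phi>' x = \<psi>' x + \<beta> * V x" for x
  have D\<psi>: "(\<psi> has_real_derivative \<psi>' x) (at x within {0..L})" for x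
    unfolding \<psi>_def[abs_def] \<psi>'_def by (intro DERIV_sum DERIV_cmult neumann_mode_DERIV)
  have \<psi>: "continuous_on {0..L} \<psi>" "continuous_on {0..L} \<psi>'"
    unfolding \<psi>_def \<psi>'_def
    by (intro continuous_intros continuous_on_neumann_mode continuous_on_neumann_mode_deriv)+
  have \<phi>: "continuous_on {0..L} \<phi>" "continuous_on {0..L} \<phi>'"
    unfolding \<phi>_def \<phi>'_def by (intro continuous_intros \<psi> U V)+
  have D\<phi>: "(\<phi> has_real_derivative \<phi>' x) (at x within {0..L})" if "x \<in> {0..L}" for x
    unfolding \<phi>_def[abs_def] \<phi>'_def by (auto intro!: derivative_eq_intros D\<psi> DU[OF that])
  have "\<phi> (y (2 * k + 1)) = 0" if "k \<le> n" for k
    using b(2)[OF that] by (simp add: \<phi>_def \<psi>_def \<beta>_def e_def mult.commute)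
  then have "0 \<le> integral {0..L} (\<lambda>x. (\<phi>' x)\<^sup>2 - a x * (\<phi> x)\<^sup>2)"
    using y(3) odd_nodes[of \<phi>] \<phi> D\<phi> upper by (intro form(1) int_a continuous_intros) (auto simp: z_def w_def)
  also have "\<dots> = integral {0..L} (\<lambda>x. (\<psi>' x)\<^sup>2 - a x * (\<psi> x)\<^sup>2)"
  proof (rule integral_unique, rule has_integral_eq)
    \<comment> \<open>Tested with \<open>\<psi>\<close>, the weak equation removes the mixed term of
      the expanded form; tested with \<open>U\<close>, it removes the term in
      \<open>\<beta>\<^sup>2\<close>.\<close>
    have orth: "((\<lambda>x. V x * g' x - a x * (U x * g x)) has_integral 0) {0..L}"
      if "\<And>x. x \<in> {0..L} \<Longrightarrow> (g has_real_derivative g' x) (at x within {0..L})" "continuous_on {0..L} g'" for g g'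
    proof -
      have "continuous_on {0..L} g"
        using that(1) by (rule DERIV_continuous_on)
      then have "(\<lambda>x. V x * g' x) integrable_on {0..L}" "(\<lambda>x. a x * (U x * g x)) integrable_on {0..L}"
        by (intro integrable_continuous_real int_a' continuous_intros U V that(2))+
      then show ?thesis
        using weak[OF that] has_integral_diff[OF integrable_integral integrable_integral] by fastforce
    qed
    have "((\<lambda>x. ((\<psi>' x)\<^sup>2 - a x * (\<psi> x)\<^sup>2) + ((2 * \<beta>) * (V x * \<psi>' x - a x * (U x * \<psi> x))
        + \<beta>\<^sup>2 * (V x * V x - a x * (U x * U x)))) has_integral
        integral {0..L} (\<lambda>x. (\<psi>' x)\<^sup>2 - a x * (\<psi> x)\<^sup>2) + ((2 * \<beta>) * 0 + \<beta>\<^sup>2 * 0)) {0..L}"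
      by (intro has_integral_add has_integral_mult_right integrable_integral integrable_diff int_a'
          integrable_continuous_real continuous_intros \<psi> orth[OF D\<psi> \<psi>(2)] orth[OF DU V])
    then show "((\<lambda>x. ((\<psi>' x)\<^sup>2 - a x * (\<psi> x)\<^sup>2) + ((2 * \<beta>) * (V x * \<psi>' x - a x * (U x * \<psi> x))
        + \<beta>\<^sup>2 * (V x * V x - a x * (U x * U x)))) has_integral
        integral {0..L} (\<lambda>x. (\<psi>' x)\<^sup>2 - a x * (\<psi> x)\<^sup>2)) {0..L}"
      by (simp only: mult_zero_right add_0_right)
  qed (auto simp: \<phi>_def \<phi>'_def power2_eq_square algebra_simps)
  \<comment> \<open>Replacing \<open>a\<close> by the constant eigenvalue separates a form that is
    diagonal in the modes from a remainder of known sign.\<close>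
  also have "\<dots> = integral {0..L} (\<lambda>x. (\<psi>' x)\<^sup>2 - ?\<mu> * (\<psi> x)\<^sup>2) - integral {0..L} (\<lambda>x. (a x - ?\<mu>) * (\<psi> x)\<^sup>2)"
  proof (rule integral_unique, rule has_integral_eq)
    have gap_int: "(\<lambda>x. (a x - ?\<mu>) * (\<psi> x)\<^sup>2) integrable_on {0..L}"
      unfolding left_diff_distrib
      by (intro integrable_diff int_a' integrable_continuous_real continuous_intros \<psi>)
    show "((\<lambda>x. ((\<psi>' x)\<^sup>2 - ?\<mu> * (\<psi> x)\<^sup>2) - (a x - ?\<mu>) * (\<psi> x)\<^sup>2) has_integral
        integral {0..L} (\<lambda>x. (\<psi>' x)\<^sup>2 - ?\<mu> * (\<psi> x)\<^sup>2) - integral {0..L} (\<lambda>x. (a x - ?\<mu>) * (\<psi> x)\<^sup>2)) {0..L}"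
      by (rule has_integral_diff[OF integrable_integral integrable_integral[OF gap_int]])
        (intro integrable_continuous_real continuous_intros \<psi>)
  qed (simp add: algebra_simps)
  finally have le: "integral {0..L} (\<lambda>x. (a x - ?\<mu>) * (\<psi> x)\<^sup>2) \<le> integral {0..L} (\<lambda>x. (\<psi>' x)\<^sup>2 - ?\<mu> * (\<psi> x)\<^sup>2)"
    by simp
  define T where "T j = (b j)\<^sup>2 * (neumann_eigenvalue L j - ?\<mu>) * integral {0..L} (\<lambda>x. (neumann_mode L j x)\<^sup>2)" for j
  have modes: "integral {0..L} (\<lambda>x. (\<psi>' x)\<^sup>2 - ?\<mu> * (\<psi> x)\<^sup>2) = (\<Sum>j\<le>n. T j)"
    unfolding \<psi>_def \<psi>'_def T_def by (rule neumann_modes_quadratic_form[OF L]) simp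
  have T: "T j \<le> 0" if "j \<le> n" for j
  proof -
    have "neumann_eigenvalue L j - ?\<mu> \<le> 0"
      using that neumann_eigenvalue_less_iff[OF L, of n j] by auto
    then show ?thesis
      unfolding T_def using neumann_mode_norm_pos[OF L, of j]
      by (intro mult_nonpos_nonneg mult_nonneg_nonpos) auto
  qed
  have gap: "integrable (lebesgue_on {0<..<L}) (\<lambda>x. (a x - ?\<mu>) * (\<psi> x)\<^sup>2)"
    "AE x in lebesgue_on {0<..<L}. 0 \<le> (a x - ?\<mu>) * (\<psi> x)\<^sup>2"
  proof -
    have a\<psi>: "integrable (lebesgue_on {0<..<L}) (\<lambda>x. a x * (\<psi> x)\<^sup>2)"
      unfolding integrable_lebesgue_on_Ioo_iff by (intro int_a continuous_intros \<psi>)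
    show "integrable (lebesgue_on {0<..<L}) (\<lambda>x. (a x - ?\<mu>) * (\<psi> x)\<^sup>2)"
      unfolding left_diff_distrib
      by (rule Bochner_Integration.integrable_diff[OF a\<psi>])
        (intro continuous_on_imp_integrable_Ioo continuous_intros \<psi>)
    show "AE x in lebesgue_on {0<..<L}. 0 \<le> (a x - ?\<mu>) * (\<psi> x)\<^sup>2"
      using lower by eventually_elim simp
  qed
  \<comment> \<open>The gap integral is nonnegative and at most the sum of the \<open>T j\<close>,
    which is nonpositive; so both are zero.\<close>
  have sum_T: "(\<Sum>j\<le>n. T j) = 0" and "integral {0..L} (\<lambda>x. (a x - ?\<mu>) * (\<psi> x)\<^sup>2) = 0"
    using le modes integral_nonneg_AE_Ioo(1)[OF gap] sum_nonpos[of "{..n}" T] T by auto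
  then have gap0: "AE x in lebesgue_on {0<..<L}. (a x - ?\<mu>) * (\<psi> x)\<^sup>2 = 0"
    by (intro integral_nonneg_AE_Ioo(2)[OF gap])
  \<comment> \<open>Nonpositive terms with sum zero all vanish, and below \<open>n\<close> the
    eigenvalue factor in \<open>T j\<close> is strictly negative.\<close>
  have b_low: "b j = 0" if "j < n" for j
  proof -
    have "T j = 0"
      using sum_T T that sum_nonneg_eq_0_iff[of "{..n}" "\<lambda>j. - T j"] by (simp add: sum_negf)
    moreover have "neumann_eigenvalue L j < ?\<mu>"
      using that neumann_eigenvalue_less_iff[OF L] by simp
    ultimately show ?thesis
      using neumann_mode_norm_pos[OF L, of j] by (simp add: T_def)
  qed
  have \<psi>_eq: "\<psi> x = b n * neumann_mode L n x" for x
    unfolding \<psi>_def using b_low by (subst sum.remove[of _ n]) auto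
  \<comment> \<open>\<open>T n\<close> is zero for any \<open>b n\<close>, so the gap integral has
    to decide: a surviving top mode would force \<open>a\<close> to equal the eigenvalue almost
    everywhere.\<close>
  have "b n = 0"
  proof (rule ccontr)
    assume "b n \<noteq> 0"
    have "AE x in lebesgue_on {0<..<L}. a x = ?\<mu>"
      using gap0 AE_neumann_mode_nonzero[OF L, of n "{0<..<L}"] n \<open>b n \<noteq> 0\<close>
      by (auto simp: \<psi>_eq elim: eventually_elim2)
    with lower_strict show False ..
  qed
  have b_zero: "b j = 0" if "j \<le> n" for j
    using that b_low \<open>b n = 0\<close> by (cases "j = n") auto
  \<comment> \<open>Only the coefficient of \<open>U\<close> is left to be nonzero, so the node
    equations now concern \<open>U\<close> alone.\<close>
  with b(1) have "\<beta> \<noteq> 0"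
    by (auto simp: \<beta>_def le_Suc_eq)
  have U_nodes: "U (y (2 * k + 1)) = 0" if "k \<le> n" for k
    using b(2)[OF that] b_zero \<open>\<beta> \<noteq> 0\<close> by (simp add: \<beta>_def e_def)
  \<comment> \<open>Using \<open>U\<close> itself as variation gives the form the value zero, the
    equality case of \<open>form\<close>.\<close>
  have "integral {0..L} (\<lambda>x. (V x)\<^sup>2 - a x * (U x)\<^sup>2) = 0"
  proof -
    have "(\<lambda>x. V x * V x) integrable_on {0..L}" "(\<lambda>x. a x * (U x * U x)) integrable_on {0..L}"
      by (intro integrable_continuous_real int_a' continuous_intros U V)+
    then show ?thesis
      using weak[OF DU V] by (simp add: power2_eq_square Henstock_Kurzweil_Integration.integral_diff)
  qed
  then have pieces: "(\<exists>c. \<forall>x\<in>{y i..y (Suc i)}. U x = c * sin (w i * (x - z i)) \<and> V x = c * w i * cos (w i * (x - z i))) \<and>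
      (AE x in lebesgue_on {y i<..<y (Suc i)}. ((w i)\<^sup>2 - a x) * (U x)\<^sup>2 = 0)" if "i < ?m" for i
    using y(3) odd_nodes[of U] U_nodes U V DU upper that
    by (intro form(2) int_a continuous_intros) (auto simp: z_def w_def)
  have w_pos: "w i > 0" if "i < ?m" for i
    using y(3)[OF that] by (simp add: w_def)
  \<comment> \<open>Sine and cosine have no common zero, so vanishing of \<open>U\<close> and
    \<open>V\<close> at a single point of a piece kills the amplitude \<open>c\<close>.\<close>
  have zero_piece: "\<forall>x\<in>{y i..y (Suc i)}. U x = 0 \<and> V x = 0"
    if t: "i < ?m" "t \<in> {y i..y (Suc i)}" "U t = 0" "V t = 0" for i t
  proof -
    obtain c where c: "\<And>x. x \<in> {y i..y (Suc i)} \<Longrightarrow>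
        U x = c * sin (w i * (x - z i)) \<and> V x = c * w i * cos (w i * (x - z i))"
      using pieces[OF t(1)] by blast
    have "c = 0"
    proof (rule ccontr)
      assume "c \<noteq> 0"
      then have "sin (w i * (t - z i)) = 0" "cos (w i * (t - z i)) = 0"
        using c[OF t(2)] t(3,4) w_pos[OF t(1)] by auto
      then show False
        using sin_cos_squared_add[of "w i * (t - z i)"] by simp
    qed
    with c show ?thesis by auto
  qed
  obtain i0 where i0: "i0 < ?m" "\<not> (AE x in lebesgue_on {y i0<..<y (Suc i0)}. a x = (w i0)\<^sup>2)"
    using upper_strict by (auto simp: w_def)
  \<comment> \<open>With a nonzero amplitude, \<open>U\<close> has no zero inside this piece, and
    the vanishing of \<open>((w i0)\<^sup>2 - a) U\<^sup>2\<close> would make \<open>a\<close> the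
    extremal constant there.\<close>
  have start: "\<exists>t\<in>{y i0..y (Suc i0)}. U t = 0 \<and> V t = 0"
  proof -
    let ?I = "{y i0<..<y (Suc i0)}"
    obtain c where c: "\<And>x. x \<in> {y i0..y (Suc i0)} \<Longrightarrow>
        U x = c * sin (w i0 * (x - z i0)) \<and> V x = c * w i0 * cos (w i0 * (x - z i0))"
      using pieces[OF i0(1)] by blast
    have "c = 0"
    proof (rule ccontr)
      assume "c \<noteq> 0"
      have U_nz: "U x \<noteq> 0" if "x \<in> ?I" for x
      proof -
        have "sin (w i0 * (x - z i0)) \<noteq> 0"
        proof (rule sin_nonzero_of_abs_le_half_pi)
          have "\<bar>x - z i0\<bar> \<le> y (Suc i0) - y i0"
            using that by (auto simp: z_def)
          then have "w i0 * \<bar>x - z i0\<bar> \<le> w i0 * (y (Suc i0) - y i0)"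
            using w_pos[OF i0(1)] by simp
          moreover have "w i0 * (y (Suc i0) - y i0) = pi / 2"
            using y(3)[OF i0(1)] by (simp add: w_def field_simps)
          ultimately show "\<bar>w i0 * (x - z i0)\<bar> \<le> pi / 2"
            using w_pos[OF i0(1)] by (simp add: abs_mult)
        qed (use that w_pos[OF i0(1)] in \<open>auto simp: z_def split: if_splits\<close>)
        then show ?thesis
          using c[of x] that \<open>c \<noteq> 0\<close> by auto
      qed
      have "AE x in lebesgue_on ?I. ((w i0)\<^sup>2 - a x) * (U x)\<^sup>2 = 0"
        using pieces[OF i0(1)] by blast
      moreover have "AE x in lebesgue_on ?I. x \<in> ?I"
        using AE_space[of "lebesgue_on ?I"] by simp
      ultimately have "AE x in lebesgue_on ?I. a x = (w i0)\<^sup>2"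
        by eventually_elim (use U_nz in auto)
      with i0(2) show False ..
    qed
    with c[of "y i0"] y(3)[OF i0(1)] show ?thesis
      by (intro bexI[of _ "y i0"]) auto
  qed
  \<comment> \<open>Adjacent pieces share a node, so zero data spread in both directions: from
    \<open>i0\<close> down to 0, and from 0 to every node.\<close>
  have nodes: "U (y i) = 0 \<and> V (y i) = 0" if "i \<le> ?m" for i
  proof -
    define N where "N i \<longleftrightarrow> U (y i) = 0 \<and> V (y i) = 0" for i
    have step: "N i = N (Suc i)" if "i < ?m" for i
    proof -
      have "y i \<in> {y i..y (Suc i)}" "y (Suc i) \<in> {y i..y (Suc i)}"
        using y(3)[OF that] by auto
      then show ?thesis
        unfolding N_def using zero_piece[OF that] by blast
    qed
    have from_0: "N i = N 0" if "i \<le> ?m" for i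
      using that
    proof (induction i)
      case (Suc i)
      then show ?case
        using step[of i] by simp
    qed simp
    have "N i0"
    proof -
      have "y i0 \<in> {y i0..y (Suc i0)}"
        using y(3)[OF i0(1)] by auto
      then show ?thesis
        unfolding N_def using start zero_piece[OF i0(1)] by blast
    qed
    then show ?thesis
      using from_0[of i0] from_0[OF that] i0(1) unfolding N_def by simp
  qed
  obtain i where i: "i < ?m" "x \<in> {y i..y (Suc i)}"
    using in_partition_interval[of x y ?m] x y by auto
  then show ?thesis
    using zero_piece[OF i(1), of "y i"] nodes[of i] y(3)[OF i(1)] by simp
qed

section \<open>Return to weak solutions\<close>

text \<open>Changing the zero function on a null set preserves absolute integrability, whatever the
  new values are; this also supplies measurability.\<close>

lemma integrable_AE_zero_Ioo:
  fixes u :: "real \<Rightarrow> real"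
  assumes "AE x in lebesgue_on {l<..<r}. u x = 0"
  shows "integrable (lebesgue_on {l<..<r}) u"
proof -
  have "negligible {x \<in> {l<..<r}. u x \<noteq> 0}"
    using assms by (simp add: AE_lebesgue_on_iff_negligible)
  then have "u absolutely_integrable_on {l<..<r}"
    by (rule absolutely_integrable_spike[where f = "\<lambda>_. 0", rotated]) auto
  then show ?thesis
    by (simp add: absolutely_integrable_imp_integrable)
qed

text \<open>Trivial means zero almost everywhere here, so every such representative must be seen to
  be a solution; the zero function serves as its weak derivative.\<close>

lemma neumann_weak_solution_AE_zero:
  assumes "AE x in lebesgue_on {0<..<L}. u x = 0"
  shows "neumann_weak_solution L a u"
  unfolding neumann_weak_solution_def
proof (intro exI[of _ "\<lambda>_. 0"] conjI allI impI)
  have zero: "(LINT x|lebesgue_on {0<..<L}. g x * u x * f x) = 0" for g f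
    using assms by (intro integral_eq_zero_AE) (auto elim: eventually_mono)
  show "(LINT x|lebesgue_on {0<..<L}. 0 * \<phi>' x) = (LINT x|lebesgue_on {0<..<L}. a x * u x * \<phi> x)" for \<phi> \<phi>'
    using zero[of a \<phi>] by simp
  have "AE x in lebesgue_on {0<..<L}. (u x)\<^sup>2 = 0"
    using assms by eventually_elim simp
  then have "in_L2 {0<..<L} u"
    unfolding in_L2_def using assms
    by (auto intro: integrable_AE_zero_Ioo borel_measurable_integrable)
  moreover have "has_weak_derivative {0<..<L} u (\<lambda>_. 0)"
    using zero[of "\<lambda>_. 1"] by (simp add: has_weak_derivative_def)
  ultimately show "H1_with_derivative {0<..<L} u (\<lambda>_. 0)"
    by (simp add: H1_with_derivative_def in_L2_def)
qed

theorem theorem3p1: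
  fixes L :: real and n :: nat and a :: "real \<Rightarrow> real" and y :: "nat \<Rightarrow> real"
  assumes "L > 0" and "n \<ge> 1"
    and "in_Linf {0<..<L} a"
    and "prec_ae L (\<lambda>x. neumann_eigenvalue L n) a"
    and "y 0 = 0" and "y (2 * n + 2) = L"
    and "\<forall>i\<in>{0..2 * n + 1}. y i < y (i + 1)"
    and "Max ((\<lambda>i. ereal ((y (i + 1) - y i)\<^sup>2) * Linf_norm {y i<..<y (i + 1)} a) ` {0..2 * n + 1})
           \<le> ereal (pi\<^sup>2 / 4)"
    and "\<exists>i\<in>{0..2 * n + 1}.
           \<not> (AE x in lebesgue_on {y i..y (i + 1)}. a x = pi\<^sup>2 / (4 * (y (i + 1) - y i)\<^sup>2))"
  shows "\<forall>u. neumann_weak_solution L a u \<longleftrightarrow> (AE x in lebesgue_on {0<..<L}. u x = 0)"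
proof (intro allI iffI)
  fix u :: "real \<Rightarrow> real"
  assume "AE x in lebesgue_on {0<..<L}. u x = 0"
  then show "neumann_weak_solution L a u"
    by (rule neumann_weak_solution_AE_zero)
next
  fix u
  assume sol: "neumann_weak_solution L a u"
  \<comment> \<open>The constant in the hypotheses is the square of the quarter-wave frequency of
    the piece.\<close>
  have sq: "(pi / (2 * (y (i + 1) - y i)))\<^sup>2 = pi\<^sup>2 / (4 * (y (i + 1) - y i)\<^sup>2)" for i
    by (simp add: power_divide power_mult_distrib[of 2] del: right_diff_distrib_numeral)
  have lower: "AE x in lebesgue_on {0<..<L}. neumann_eigenvalue L n \<le> a x"
    using assms(4) unfolding prec_ae_def AE_lebesgue_on_Ioo_iff_Icc by blast
  have lower_strict: "\<not> (AE x in lebesgue_on {0<..<L}. a x = neumann_eigenvalue L n)"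
  proof
    assume "AE x in lebesgue_on {0<..<L}. a x = neumann_eigenvalue L n"
    then have "AE x in lebesgue_on {0..L}. \<not> neumann_eigenvalue L n < a x"
      unfolding AE_lebesgue_on_Ioo_iff_Icc by eventually_elim simp
    then have "emeasure (lebesgue_on {0..L}) {x \<in> space (lebesgue_on {0..L}). neumann_eigenvalue L n < a x} = 0"
      by (rule emeasure_eq_0_AE)
    then show False
      using assms(4) by (simp add: prec_ae_def)
  qed
  have y: "y i < y (Suc i)" if "i < 2 * n + 2" for i
    using assms(7) that by auto
  have upper: "AE x in lebesgue_on {y i<..<y (Suc i)}. a x \<le> (pi / (2 * (y (Suc i) - y i)))\<^sup>2"
    if i: "i < 2 * n + 2" for i
  proof -
    let ?N = "Linf_norm {y i<..<y (Suc i)} a"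
    have h: "(y (Suc i) - y i)\<^sup>2 > 0"
      using y[OF i] by simp
    have "ereal ((y (i + 1) - y i)\<^sup>2) * Linf_norm {y i<..<y (i + 1)} a \<le>
        Max ((\<lambda>i. ereal ((y (i + 1) - y i)\<^sup>2) * Linf_norm {y i<..<y (i + 1)} a) ` {0..2 * n + 1})"
      using i by (intro Max_ge) auto
    from order_trans[OF this assms(8)] have N: "ereal ((y (Suc i) - y i)\<^sup>2) * ?N \<le> ereal (pi\<^sup>2 / 4)"
      by (simp only: Suc_eq_plus1)
    have "AE x in lebesgue_on {y i<..<y (Suc i)}. ereal \<bar>a x\<bar> \<le> ?N"
      unfolding Linf_norm_def by (rule esssup_AE)
    then show ?thesis
    proof eventually_elim
      case (elim x)
      show ?case
      \<comment> \<open>The value plus infinity contradicts \<open>N\<close>, as the squared length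
        is positive; minus infinity cannot bound an absolute value.\<close>
      proof (cases ?N)
        case (real r)
        then have "(y (Suc i) - y i)\<^sup>2 * r \<le> pi\<^sup>2 / 4" "\<bar>a x\<bar> \<le> r"
          using N elim by auto
        then have "r \<le> (pi / (2 * (y (Suc i) - y i)))\<^sup>2"
          unfolding Suc_eq_plus1 sq using h by (simp add: field_simps)
        with \<open>\<bar>a x\<bar> \<le> r\<close> show ?thesis by simp
      next
        case PInf
        then show ?thesis using N h by simp
      next
        case MInf
        then show ?thesis using elim by simp
      qed
    qed
  qed
  have upper_strict: "\<exists>i<2 * n + 2.
      \<not> (AE x in lebesgue_on {y i<..<y (Suc i)}. a x = (pi / (2 * (y (Suc i) - y i)))\<^sup>2)"
  proof -
    obtain i where "i \<in> {0..2 * n + 1}"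
      "\<not> (AE x in lebesgue_on {y i..y (i + 1)}. a x = pi\<^sup>2 / (4 * (y (i + 1) - y i)\<^sup>2))"
      using assms(9) by blast
    then show ?thesis
      unfolding Suc_eq_plus1 sq AE_lebesgue_on_Ioo_iff_Icc by (intro exI[of _ i] conjI) (simp, assumption)
  qed
  obtain U V where "AE x in lebesgue_on {0<..<L}. u x = U x"
    and "\<And>x. x \<in> {0..L} \<Longrightarrow> (U has_real_derivative V x) (at x within {0..L})"
    and "continuous_on {0..L} V"
    and "\<And>\<phi> \<phi>'. (\<And>x. x \<in> {0..L} \<Longrightarrow> (\<phi> has_real_derivative \<phi>' x) (at x within {0..L})) \<Longrightarrow>
           continuous_on {0..L} \<phi>' \<Longrightarrow>
           integral {0..L} (\<lambda>x. V x * \<phi>' x) = integral {0..L} (\<lambda>x. a x * (U x * \<phi> x))"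
    using neumann_weak_solution_regular[OF assms(1,3) sol] by blast
  note regular = this
  have "U x = 0" if "x \<in> {0..L}" for x
    using neumann_regular_solution_trivial[OF assms(1,2) in_Linf_imp_integrable[OF assms(3)]
        lower lower_strict assms(5,6) y upper upper_strict regular(2-4) that] .
  with regular(1) AE_space[of "lebesgue_on {0<..<L}"]
  show "AE x in lebesgue_on {0<..<L}. u x = 0"
    by (auto elim: eventually_elim2)
qed

end
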